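(* Let $(G,H_0,H)$ be continuously embedded separable Hilbert spaces and let $L:G\to H$ and $A=(A^j)_{j\in\mathbb N}:G\to\ell^2(H)$ be continuous. Let $T=(T(t))_{t\in\mathbb R^d}$ be a multi-parameter $C_0$-group on $H$ with generator $B=(B_1,\ldots,B_d)$ such that $T|_G$ and $T|_{H_0}$ are multi-parameter $C_0$-groups on $G$ and $H_0$, $H_0\subset D(B)$, $G\subset D(B^2)$, and $B_i|_{H_0}\in L(H_0,H)$, $B_i|_G\in L(G,H_0)$ (bounded linear operators) for $i=1,\ldots,d$. Let $m\le d$ and let $\mathcal M$ be an $m$-dimensional $(G,H_0,H)$-submanifold of class $C^2$ which is locally invariant for the SPDE $dY_t=L(Y_t)\,dt+A(Y_t)\,dW_t$. Suppose that for each $j=1,\ldots,m$ we have $A^j\in C(G;H_0)$ with an extension $A^j\in C^1(H_0;H)$. Let $y_0\in\mathcal M$ and let $\phi:V\to U\cap\mathcal M$ be a local parametrization of $\mathcal M$ around $y_0$ with $\phi\in C(V;G)\cap C^1(V;H_0)\cap C^2(V;H)$; set $x_0:=\phi^{-1}(y_0)$. Assume there is a $C^1$-mapping $\Lambda:V\to\mathbb R^{m\times d}$ such that $$A^j(y)=\sum_{k=1}^d\Lambda_{jk}(\phi^{-1}(y))\,B_ky,\quad y\in U\cap\mathcal M,\ j=1,\ldots,m,$$ and that $A^1(y),\ldots,A^m(y)$ are linearly independent for each $y\in U\cap\mathcal M$. Let $\Gamma:V\to\mathbb R^{m\times m}$ be the unique mapping (it is of class $C^1$) such that $$\partial_i\phi(x)=\sum_{j=1}^m\Gamma_{ij}(x)A^j(\phi(x)),\quad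 x\in V,\ i=1,\ldots,m,$$ and set $\Phi:=\Gamma\cdot\Lambda:V\to\mathbb R^{m\times d}$. Let $\psi\in C^2(\mathbb R^d;H)$ be the orbit map $\psi(t)=T(t)y_0$. Suppose that $\Phi$ has a primitive and that $\operatorname{rk}\Phi(x_0)=m$. Then there exist an $m$-dimensional $C^2$-submanifold $\mathcal N$ of $\mathbb R^d$ and an open neighborhood $U_0\subset U$ of $y_0$ such that the submanifold $U_0\cap\mathcal M$ is induced by $(\psi,\mathcal N)$.
   Context: All spaces are real. $(G,H_0,H)$ are continuously embedded if $G\subset H_0\subset H$ as sets with continuous inclusions. $\ell^2(H)$ is the Hilbert space of sequences $(y^j)_{j\in\mathbb N}$ in $H$ with $\sum_j\|y^j\|_H^2<\infty$. Multi-parameter $C_0$-group on $H$: a family $T=(T(t))_{t\in\mathbb R^d}$ of bounded linear operators on $H$ with $T(0)=\mathrm{Id}$, $T(t+s)=T(t)T(s)$, and $t\mapsto T(t)x$ continuous for each $x\in H$. Its generator is $B=(B_1,\ldots,B_d)$, where $B_i$ is the generator of the one-parameter $C_0$-group $t\mapsto T(te_i)$. $D(B)=\bigcap_iD(B_i)$ and $D(B^2)=\{x\in D(B):B_ix\in D(B)\ \forall i\}$. A $C^1$-mapping $\varphi:V\to\mathbb R^d$ is a primitive of $\Phi:V\to\mathbb R^{m\times d}$ if $\Phi_{ij}=\partial_i\varphi_j$ for all $i=1,\ldots,m$, $j=1,\ldots,d$. A standard $\mathbb R^\infty$-Wiener process is a sequence $W=(W^j)_{j\in\mathbb N}$ of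 independent real standard Wiener processes on a stochastic basis (filtered probability space satisfying the usual conditions); $\int_0^tA_s\,dW_s:=\sum_{j}\int_0^tA^j_s\,dW^j_s$. A local martingale solution of the SPDE with $Y_0=y\in G$ is a triplet $(\mathbb B,W,Y)$ of a stochastic basis, a standard $\mathbb R^\infty$-Wiener process $W$ on it, and a $G$-valued adapted process $Y$ such that for some stopping time $\tau>0$ (the lifetime) almost surely $\int_0^{t\wedge\tau}(\|L(Y_s)\|_H+\|A(Y_s)\|^2_{\ell^2(H)})ds<\infty$ and $Y_{t\wedge\tau}=y+\int_0^{t\wedge\tau}L(Y_s)ds+\int_0^{t\wedge\tau}A(Y_s)dW_s$ for all $t\ge0$ (integrals in $H$). $\mathcal M\subset G$ is locally invariant if for each $y\in\mathcal M$ there is a local martingale solution $Y$ with $Y_0=y$ and lifetime $\tau>0$ such that $Y_{\cdot\wedge\tau}\in\mathcal M$ up to an evanescent set. A subset $\mathcal M$ of a Hilbert space $H$ is an $m$-dimensional $C^k$-submanifold of $H$ if for every $y\in\mathcal M$ there are an open neighborhood $U\subset H$ of $y$, an open $V\subset\mathbb R^m$ and $\phi\in C^k(V;H)$ such that $\phi:V\to U\cap\mathcal M$ is a homeomorphism and $D\phi(x)$ is one-to-one for all $x\in V$ (a local parametrization around $y$); $T_y\mathcal M:=D\phi(x)\mathbb R^m$ with $x=\phi^{-1}(y)$. $\mathcal M$ is a $(G,H_0,H)$-submanifold of class $C^2$ if it is an $m$-dimensional $C^2$-submanifold of $H$ and an $m$-dimensional $C^1$-submanifold of $H_0$, $\mathcal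 M\subset G$, and the topologies induced on $\mathcal M$ by $\|\cdot\|_H$ and $\|\cdot\|_G$ coincide; local parametrizations $\phi$ with the regularity in the claim then exist around each point. Local invariance implies $A^j(y)\in T_y\mathcal M$ for $y\in\mathcal M$, so $A^1(y),\ldots,A^m(y)$ form a basis of $T_y\mathcal M$ for $y\in U\cap\mathcal M$ and $\Gamma$ is well defined. A submanifold $\mathcal M'$ of $H$ is induced by $(\psi,\mathcal N)$, where $\mathcal N$ is an $m$-dimensional $C^2$-submanifold of $\mathbb R^d$, if $\psi|_{\mathcal N}:\mathcal N\to\psi(\mathcal N)$ is a homeomorphism, $D\psi(x)|_{T_x\mathcal N}$ is one-to-one for every $x\in\mathcal N$, and $\mathcal M'=\psi(\mathcal N)$. *)

theory Defs
  imports "HOL-Probability.Probability"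
begin

section \<open>Differential calculus\<close>

text \<open>Both notions are meant for an open domain \<open>V\<close>.\<close>

definition C1_on :: "'a::real_normed_vector set \<Rightarrow> ('a \<Rightarrow> 'b::real_normed_vector) \<Rightarrow> bool" where
  "C1_on V f \<longleftrightarrow> (\<exists>f' :: 'a \<Rightarrow> 'a \<Rightarrow>\<^sub>L 'b.
      (\<forall>x\<in>V. (f has_derivative blinfun_apply (f' x)) (at x)) \<and> continuous_on V f')"

definition C2_on :: "'a::real_normed_vector set \<Rightarrow> ('a \<Rightarrow> 'b::real_normed_vector) \<Rightarrow> bool" where
  "C2_on V f \<longleftrightarrow> (\<exists>f' :: 'a \<Rightarrow> 'a \<Rightarrow>\<^sub>L 'b.
      (\<forall>x\<in>V. (f has_derivative blinfun_apply (f' x)) (at x)) \<and> C1_on V f')"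

definition partial_derivative :: "'n::finite \<Rightarrow> (real^'n \<Rightarrow> 'b::real_normed_vector) \<Rightarrow> real^'n \<Rightarrow> 'b" where
  "partial_derivative i f x = vector_derivative (\<lambda>s. f (x + s *\<^sub>R axis i 1)) (at 0)"

definition primitive_on ::
    "(real^'m::finite) set \<Rightarrow> (real^'m \<Rightarrow> real^'d::finite^'m) \<Rightarrow> (real^'m \<Rightarrow> real^'d) \<Rightarrow> bool" where
  "primitive_on V \<Phi> p \<longleftrightarrow> C1_on V p \<and>
     (\<forall>x\<in>V. \<forall>i j. \<Phi> x $ i $ j = partial_derivative i (\<lambda>z. p z $ j) x)"


section \<open>Submanifolds\<close>

text \<open>The argument \<open>C\<close> is the regularity class, \<^const>\<open>C1_on\<close> or \<^const>\<open>C2_on\<close>.\<close>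

definition local_parametrization ::
    "((real^'m::finite) set \<Rightarrow> (real^'m \<Rightarrow> 'h::real_normed_vector) \<Rightarrow> bool) \<Rightarrow>
     'h set \<Rightarrow> (real^'m) set \<Rightarrow> 'h set \<Rightarrow> (real^'m \<Rightarrow> 'h) \<Rightarrow> bool" where
  "local_parametrization C U V M \<phi> \<longleftrightarrow> open U \<and> open V \<and> C V \<phi> \<and>
     (\<exists>g. homeomorphism V (U \<inter> M) \<phi> g) \<and>
     (\<forall>x\<in>V. inj (frechet_derivative \<phi> (at x)))"

text \<open>The dimension of the submanifold is the cardinality of the index type \<open>'m\<close>.\<close>

definition C1_submanifold :: "'m::finite itself \<Rightarrow> 'h::real_normed_vector set \<Rightarrow> bool" where
  "C1_submanifold _ M \<longleftrightarrow> (\<forall>y\<in>M. \<exists>U V (\<phi> :: real^'m \<Rightarrow> 'h).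
      y \<in> U \<and> local_parametrization C1_on U V M \<phi>)"

definition C2_submanifold :: "'m::finite itself \<Rightarrow> 'h::real_normed_vector set \<Rightarrow> bool" where
  "C2_submanifold _ M \<longleftrightarrow> (\<forall>y\<in>M. \<exists>U V (\<phi> :: real^'m \<Rightarrow> 'h).
      y \<in> U \<and> local_parametrization C2_on U V M \<phi>)"

text \<open>The range of the derivative is the same for every local parametrization around \<open>y\<close>, so the
  union over all parametrizations is the tangent space given by any one of them.\<close>

definition tangent_space ::
    "'m::finite itself \<Rightarrow> 'h::real_normed_vector set \<Rightarrow> 'h \<Rightarrow> 'h set" where
  "tangent_space _ M y = {v. \<exists>U V (\<phi> :: real^'m \<Rightarrow> 'h) x.
      local_parametrization C1_on U V M \<phi> \<and> x \<in> V \<and> \<phi> x = y \<and>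
      v \<in> range (frechet_derivative \<phi> (at x))}"

text \<open>Twice continuous differentiability of \<open>\<psi>\<close> is required explicitly because
  \<^const>\<open>frechet_derivative\<close> is arbitrary where \<open>\<psi>\<close> is not differentiable.\<close>

definition induced_by ::
    "'m::finite itself \<Rightarrow> 'h::real_normed_vector set \<Rightarrow> (real^'d::finite \<Rightarrow> 'h) \<Rightarrow> (real^'d) set \<Rightarrow> bool" where
  "induced_by m M' \<psi> N \<longleftrightarrow>
     C2_submanifold m M' \<and> C2_on UNIV \<psi> \<and> C2_submanifold m N \<and>
     (\<exists>g. homeomorphism N (\<psi> ` N) \<psi> g) \<and>
     (\<forall>x\<in>N. inj_on (frechet_derivative \<psi> (at x)) (tangent_space m N x)) \<and>
     M' = \<psi> ` N"


section \<open>Continuously embedded spaces\<close>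

text \<open>The inclusions \<open>G \<subseteq> H\<^sub>0 \<subseteq> H\<close> are represented by injective bounded linear maps
  \<open>\<iota>\<^sub>G\<close> from \<open>G\<close> to \<open>H\<^sub>0\<close> and \<open>\<iota>\<close> from \<open>H\<^sub>0\<close> to \<open>H\<close> between the types of the three spaces.\<close>

definition continuous_embedding :: "('a::real_normed_vector \<Rightarrow> 'b::real_normed_vector) \<Rightarrow> bool" where
  "continuous_embedding \<iota> \<longleftrightarrow> bounded_linear \<iota> \<and> inj \<iota>"

definition GHH_submanifold_C2 ::
    "'m::finite itself \<Rightarrow> ('g::real_normed_vector \<Rightarrow> 'k::real_normed_vector) \<Rightarrow>
     ('k \<Rightarrow> 'h::real_normed_vector) \<Rightarrow> 'g set \<Rightarrow> bool" where
  "GHH_submanifold_C2 m \<iota>\<^sub>G \<iota> M \<longleftrightarrow>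
     C2_submanifold m ((\<iota> \<circ> \<iota>\<^sub>G) ` M) \<and> C1_submanifold m (\<iota>\<^sub>G ` M) \<and>
     (\<forall>S\<subseteq>M. openin (top_of_set M) S \<longleftrightarrow>
        openin (top_of_set ((\<iota> \<circ> \<iota>\<^sub>G) ` M)) ((\<iota> \<circ> \<iota>\<^sub>G) ` S))"


section \<open>Multi-parameter groups and their generators\<close>

definition C0_group :: "(real^'d::finite \<Rightarrow> 'h::real_normed_vector \<Rightarrow> 'h) \<Rightarrow> bool" where
  "C0_group T \<longleftrightarrow> (\<forall>t. bounded_linear (T t)) \<and> T 0 = id \<and> (\<forall>t s. T (t + s) = T t \<circ> T s) \<and>
     (\<forall>x. continuous_on UNIV (\<lambda>t. T t x))"

definition C0_group_restricts ::
    "(real^'d::finite \<Rightarrow> 'h::real_normed_vector \<Rightarrow> 'h) \<Rightarrow> ('a::real_normed_vector \<Rightarrow> 'h) \<Rightarrow> bool" where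
  "C0_group_restricts T \<iota> \<longleftrightarrow>
     (\<exists>S :: real^'d \<Rightarrow> 'a \<Rightarrow> 'a. C0_group S \<and> (\<forall>t x. \<iota> (S t x) = T t (\<iota> x)))"

definition generator_dom1 :: "(real \<Rightarrow> 'h::real_normed_vector \<Rightarrow> 'h) \<Rightarrow> 'h set" where
  "generator_dom1 S = {x. \<exists>z. ((\<lambda>h. (S h x - x) /\<^sub>R h) \<longlongrightarrow> z) (at 0)}"

definition generator1 :: "(real \<Rightarrow> 'h::real_normed_vector \<Rightarrow> 'h) \<Rightarrow> 'h \<Rightarrow> 'h" where
  "generator1 S x = Lim (at 0) (\<lambda>h. (S h x - x) /\<^sub>R h)"

definition generator :: "(real^'d::finite \<Rightarrow> 'h::real_normed_vector \<Rightarrow> 'h) \<Rightarrow> 'd \<Rightarrow> 'h \<Rightarrow> 'h" where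
  "generator T i = generator1 (\<lambda>s. T (s *\<^sub>R axis i 1))"

definition generator_dom :: "(real^'d::finite \<Rightarrow> 'h::real_normed_vector \<Rightarrow> 'h) \<Rightarrow> 'h set" where
  "generator_dom T = (\<Inter>i. generator_dom1 (\<lambda>s. T (s *\<^sub>R axis i 1)))"

definition generator_dom2 :: "(real^'d::finite \<Rightarrow> 'h::real_normed_vector \<Rightarrow> 'h) \<Rightarrow> 'h set" where
  "generator_dom2 T = {x \<in> generator_dom T. \<forall>i. generator T i x \<in> generator_dom T}"


section \<open>Maps into the space of square-summable sequences\<close>

text \<open>Sequences are indexed from \<open>0\<close>: the first \<open>m\<close> components have the indices \<open>{..<m}\<close>.\<close>

definition in_ell2 :: "(nat \<Rightarrow> 'h::real_normed_vector) \<Rightarrow> bool" where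
  "in_ell2 f \<longleftrightarrow> summable (\<lambda>j. (norm (f j))\<^sup>2)"

definition ell2_norm :: "(nat \<Rightarrow> 'h::real_normed_vector) \<Rightarrow> real" where
  "ell2_norm f = sqrt (\<Sum>j. (norm (f j))\<^sup>2)"

definition continuous_ell2 ::
    "(nat \<Rightarrow> 'g::topological_space \<Rightarrow> 'h::real_normed_vector) \<Rightarrow> bool" where
  "continuous_ell2 A \<longleftrightarrow> (\<forall>y. in_ell2 (\<lambda>j. A j y)) \<and>
     (\<forall>y. ((\<lambda>z. ell2_norm (\<lambda>j. A j z - A j y)) \<longlongrightarrow> 0) (at y))"


section \<open>Wiener processes\<close>

text \<open>Time is real; only \<open>t \<ge> 0\<close> matters, and \<open>F t\<close> for \<open>t < 0\<close> plays no role beyond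
  monotonicity.\<close>

locale stochastic_basis = prob_space M + complete_measure M + filtration "space M" F
  for M :: "'w measure" and F :: "real \<Rightarrow> 'w measure" +
  assumes sets_F_subset: "sets (F t) \<subseteq> sets M"
    and null_sets_F0: "null_sets M \<subseteq> sets (F 0)"
    and right_continuous: "0 \<le> t \<Longrightarrow> sets (F t) = (\<Inter>s\<in>{t<..}. sets (F s))"

definition wiener_process ::
    "'w measure \<Rightarrow> (real \<Rightarrow> 'w measure) \<Rightarrow> (real \<Rightarrow> 'w \<Rightarrow> real) \<Rightarrow> bool" where
  "wiener_process M F w \<longleftrightarrow>
     (\<forall>t\<ge>0. w t \<in> borel_measurable (F t)) \<and>
     (AE \<omega> in M. w 0 \<omega> = 0 \<and> continuous_on {0..} (\<lambda>t. w t \<omega>)) \<and>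
     (\<forall>s t. 0 \<le> s \<and> s < t \<longrightarrow>
        distributed M lborel (\<lambda>\<omega>. w t \<omega> - w s \<omega>) (normal_density 0 (sqrt (t - s))) \<and>
        prob_space.indep_set M (sets (F s))
          (sets (vimage_algebra (space M) (\<lambda>\<omega>. w t \<omega> - w s \<omega>) borel)))"

definition Rinf_wiener_process ::
    "'w measure \<Rightarrow> (real \<Rightarrow> 'w measure) \<Rightarrow> (nat \<Rightarrow> real \<Rightarrow> 'w \<Rightarrow> real) \<Rightarrow> bool" where
  "Rinf_wiener_process M F W \<longleftrightarrow> (\<forall>j. wiener_process M F (W j)) \<and>
     prob_space.indep_vars M (\<lambda>_. Pi\<^sub>M {0..} (\<lambda>_. borel)) (\<lambda>j \<omega>. \<lambda>t\<in>{0..}. W j t \<omega>) UNIV"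


section \<open>The stochastic integral\<close>

text \<open>Measurability is part of the notion, since \<^const>\<open>measure\<close> is \<open>0\<close> on non-measurable sets.\<close>

definition null_in_prob :: "'w measure \<Rightarrow> (nat \<Rightarrow> 'w \<Rightarrow> ennreal) \<Rightarrow> bool" where
  "null_in_prob M Z \<longleftrightarrow> (\<forall>n. Z n \<in> borel_measurable M) \<and>
     (\<forall>\<epsilon>>0. (\<lambda>n. measure M {\<omega> \<in> space M. ennreal \<epsilon> < Z n \<omega>}) \<longlonglongrightarrow> 0)"

text \<open>A simple integrand is a list of triples \<open>(a, b, \<xi>)\<close>, standing for the sum of the
  processes \<open>\<xi> 1\<^bsub>(a, b]\<^esub>\<close>, with \<open>\<xi>\<close> bounded and measurable at time \<open>a\<close>.\<close>

definition simple_integrand ::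
    "'w measure \<Rightarrow> (real \<Rightarrow> 'w measure) \<Rightarrow> (real \<times> real \<times> ('w \<Rightarrow> 'h::real_normed_vector)) list \<Rightarrow> bool" where
  "simple_integrand M F P \<longleftrightarrow> (\<forall>(a, b, \<xi>) \<in> set P.
     0 \<le> a \<and> a \<le> b \<and> \<xi> \<in> borel_measurable (F a) \<and> bounded (\<xi> ` space M))"

definition simple_value ::
    "(real \<times> real \<times> ('w \<Rightarrow> 'h::real_normed_vector)) list \<Rightarrow> real \<Rightarrow> 'w \<Rightarrow> 'h" where
  "simple_value P s \<omega> = (\<Sum>(a, b, \<xi>) \<leftarrow> P. indicator {a<..b} s *\<^sub>R \<xi> \<omega>)"

definition simple_integral ::
    "(real \<Rightarrow> 'w \<Rightarrow> real) \<Rightarrow> (real \<times> real \<times> ('w \<Rightarrow> 'h::real_normed_vector)) list \<Rightarrow> real \<Rightarrow> 'w \<Rightarrow> 'h" where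
  "simple_integral w P t \<omega> = (\<Sum>(a, b, \<xi>) \<leftarrow> P. (w (min b t) \<omega> - w (min a t) \<omega>) *\<^sub>R \<xi> \<omega>)"

definition continuous_adapted ::
    "'w measure \<Rightarrow> (real \<Rightarrow> 'w measure) \<Rightarrow> (real \<Rightarrow> 'w \<Rightarrow> 'h::real_normed_vector) \<Rightarrow> bool" where
  "continuous_adapted M F X \<longleftrightarrow> (\<forall>t\<ge>0. X t \<in> borel_measurable (F t)) \<and>
     (AE \<omega> in M. continuous_on {0..} (\<lambda>t. X t \<omega>))"

text \<open>\<open>I\<^sub>t = \<integral>\<^sub>0\<^sup>t X\<^sub>s dw\<^sub>s\<close> for a single Wiener process \<open>w\<close>: the limit in probability of the integrals
  of simple integrands \<open>P n\<close> with \<open>\<integral>\<^sub>0\<^sup>t \<parallel>P\<^sub>s n - X\<^sub>s\<parallel>\<^sup>2 ds\<close> tending to zero in probability. This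
  determines \<open>I\<close> up to indistinguishability.\<close>

definition has_ito_integral ::
    "'w measure \<Rightarrow> (real \<Rightarrow> 'w measure) \<Rightarrow> (real \<Rightarrow> 'w \<Rightarrow> real) \<Rightarrow>
     (real \<Rightarrow> 'w \<Rightarrow> 'h::real_normed_vector) \<Rightarrow> (real \<Rightarrow> 'w \<Rightarrow> 'h) \<Rightarrow> bool" where
  "has_ito_integral M F w X I \<longleftrightarrow>
     (AE \<omega> in M. set_borel_measurable borel {0..} (\<lambda>s. X s \<omega>)) \<and>
     continuous_adapted M F I \<and>
     (\<exists>P. (\<forall>n. simple_integrand M F (P n)) \<and>
        (\<forall>t\<ge>0.
           null_in_prob M (\<lambda>n \<omega>.
             \<integral>\<^sup>+ s \<in> {0..t}. ennreal ((norm (simple_value (P n) s \<omega> - X s \<omega>))\<^sup>2) \<partial>lborel) \<and>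
           null_in_prob M (\<lambda>n \<omega>. ennreal (norm (simple_integral w (P n) t \<omega> - I t \<omega>)))))"

text \<open>\<open>I\<^sub>t = \<Sum>\<^sub>j \<integral>\<^sub>0\<^sup>t X\<^sup>j\<^sub>s dW\<^sup>j\<^sub>s\<close>, the series converging in probability.\<close>

definition has_ito_integral_Rinf ::
    "'w measure \<Rightarrow> (real \<Rightarrow> 'w measure) \<Rightarrow> (nat \<Rightarrow> real \<Rightarrow> 'w \<Rightarrow> real) \<Rightarrow>
     (nat \<Rightarrow> real \<Rightarrow> 'w \<Rightarrow> 'h::real_normed_vector) \<Rightarrow> (real \<Rightarrow> 'w \<Rightarrow> 'h) \<Rightarrow> bool" where
  "has_ito_integral_Rinf M F W X I \<longleftrightarrow> continuous_adapted M F I \<and>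
     (\<exists>J. (\<forall>j. has_ito_integral M F (W j) (X j) (J j)) \<and>
        (\<forall>t\<ge>0. null_in_prob M (\<lambda>n \<omega>. ennreal (norm ((\<Sum>j<n. J j t \<omega>) - I t \<omega>)))))"


section \<open>Local martingale solutions and local invariance\<close>

text \<open>A stopping time may be infinite, hence values in \<^typ>\<open>ereal\<close>.\<close>

definition extended_stopping_time :: "(real \<Rightarrow> 'w measure) \<Rightarrow> ('w \<Rightarrow> ereal) \<Rightarrow> bool" where
  "extended_stopping_time F \<tau> \<longleftrightarrow> (\<forall>t. Measurable.pred (F t) (\<lambda>\<omega>. \<tau> \<omega> \<le> ereal t))"

definition stopped_at :: "real \<Rightarrow> ereal \<Rightarrow> real" where
  "stopped_at t u = real_of_ereal (min (ereal t) u)"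

text \<open>The integral \<open>\<integral>\<^sub>0\<^bsup>t \<and> \<tau>\<^esup> A(Y\<^sub>s) dW\<^sub>s\<close> is that of \<open>1\<^bsub>s \<le> \<tau>\<^esub> A(Y\<^sub>s)\<close> up to \<open>t\<close>, because \<open>A(Y)\<close>
  need not be integrable after \<open>\<tau>\<close>. Here \<open>j\<close> is the inclusion of \<open>G\<close> into \<open>H\<close>.\<close>

definition local_martingale_solution ::
    "('g::{real_normed_vector, second_countable_topology} \<Rightarrow>
        'h::{banach, second_countable_topology}) \<Rightarrow>
     ('g \<Rightarrow> 'h) \<Rightarrow> (nat \<Rightarrow> 'g \<Rightarrow> 'h) \<Rightarrow> 'g \<Rightarrow>
     'w measure \<Rightarrow> (real \<Rightarrow> 'w measure) \<Rightarrow> (nat \<Rightarrow> real \<Rightarrow> 'w \<Rightarrow> real) \<Rightarrow>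
     (real \<Rightarrow> 'w \<Rightarrow> 'g) \<Rightarrow> ('w \<Rightarrow> ereal) \<Rightarrow> bool" where
  "local_martingale_solution j L A y M F W Y \<tau> \<longleftrightarrow>
     stochastic_basis M F \<and> Rinf_wiener_process M F W \<and>
     (\<forall>t\<ge>0. Y t \<in> borel_measurable (F t)) \<and>
     extended_stopping_time F \<tau> \<and> (\<forall>\<omega>\<in>space M. 0 < \<tau> \<omega>) \<and>
     (AE \<omega> in M. \<forall>t\<ge>0.
        set_integrable lborel {0..stopped_at t (\<tau> \<omega>)} (\<lambda>s. L (Y s \<omega>)) \<and>
        set_integrable lborel {0..stopped_at t (\<tau> \<omega>)} (\<lambda>s. (ell2_norm (\<lambda>i. A i (Y s \<omega>)))\<^sup>2)) \<and>
     (\<exists>I. has_ito_integral_Rinf M F W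
            (\<lambda>i s \<omega>. if ereal s \<le> \<tau> \<omega> then A i (Y s \<omega>) else 0) I \<and>
        (AE \<omega> in M. \<forall>t\<ge>0.
           j (Y (stopped_at t (\<tau> \<omega>)) \<omega>) =
             j y + (LINT s:{0..stopped_at t (\<tau> \<omega>)}|lborel. L (Y s \<omega>)) + I t \<omega>))"

text \<open>HOL cannot quantify existentially over the type \<open>'w\<close> carrying the sample spaces, so it is a
  parameter. In a theorem assuming local invariance with \<open>'w\<close> a free type variable, the hypothesis
  amounts to local invariance over some type \<open>'w\<close>. The spaces may depend on \<open>y\<close>: each measure has
  its own \<^const>\<open>space\<close> inside \<open>'w\<close>.\<close>

definition locally_invariant ::
    "'w itself \<Rightarrow> ('g::{real_normed_vector, second_countable_topology} \<Rightarrow>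
        'h::{banach, second_countable_topology}) \<Rightarrow>
     ('g \<Rightarrow> 'h) \<Rightarrow> (nat \<Rightarrow> 'g \<Rightarrow> 'h) \<Rightarrow> 'g set \<Rightarrow> bool" where
  "locally_invariant _ j L A M \<longleftrightarrow>
     (\<forall>y\<in>M. \<exists>(P :: 'w measure) F W Y \<tau>. local_martingale_solution j L A y P F W Y \<tau> \<and>
        (AE \<omega> in P. \<forall>t\<ge>0. Y (stopped_at t (\<tau> \<omega>)) \<omega> \<in> M))"

end

theory Submission
  imports Defs
begin

text \<open>
  Let \<open>p\<close> be the primitive of \<open>\<Phi>\<close> with \<open>p(x\<^sub>0) = 0\<close>. The representations of \<open>A\<close> and of the partial
  derivatives of \<open>\<phi>\<close> combine to \<open>\<partial>\<^sub>i \<phi> = \<Sum>\<^sub>k \<Phi>\<^sub>i\<^sub>k B\<^sub>k \<phi>\<close>, so \<open>T(-p(x)) \<phi>(x)\<close> has derivative zero and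
  \<open>\<phi> = \<psi> \<circ> p\<close> on a ball around \<open>x\<^sub>0\<close>. Since \<open>\<phi>\<close> is an immersion and a homeomorphism onto its image,
  this factorization gives \<open>p\<close> the same two properties, with inverse \<open>\<phi>\<^sup>-\<^sup>1 \<circ> \<psi>\<close>, and \<open>N\<close> is the image of the ball
  under \<open>p\<close>. For \<open>p\<close> to be of class \<open>C\<^sup>2\<close> one needs \<open>\<Phi>\<close>, hence \<open>\<Gamma>\<close>, to be of class \<open>C\<^sup>1\<close>.
\<close>

section \<open>Continuously differentiable maps\<close>

text \<open>On a finite-dimensional domain, an operator-valued map is norm continuous as soon as its
  value at each fixed vector is continuous. Derivatives can thus be given as plain functions and
  checked direction by direction.\<close>

lemma C1_onI:
  fixes f :: "'a::euclidean_space \<Rightarrow> 'b::real_normed_vector"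
  assumes "\<And>x. x \<in> V \<Longrightarrow> (f has_derivative f' x) (at x)"
    and "\<And>h. continuous_on V (\<lambda>x. f' x h)"
  shows "C1_on V f"
proof -
  have *: "blinfun_apply (Blinfun (f' x)) = f' x" if "x \<in> V" for x
    using assms(1)[OF that] by (simp add: bounded_linear_Blinfun_apply has_derivative_bounded_linear)
  have "continuous_on V (\<lambda>x. Blinfun (f' x))"
  proof (rule continuous_on_blinfun_componentwise)
    fix i :: 'a
    show "continuous_on V (\<lambda>x. blinfun_apply (Blinfun (f' x)) i)"
      using assms(2)[of i] by (simp add: * cong: continuous_on_cong)
  qed
  with assms(1) show ?thesis
    unfolding C1_on_def by (intro exI[of _ "\<lambda>x. Blinfun (f' x)"]) (simp add: *)
qed

lemma C1_onE:
  assumes "C1_on V f"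
  obtains f' where "\<And>x. x \<in> V \<Longrightarrow> (f has_derivative f' x) (at x)"
    and "\<And>h. continuous_on V (\<lambda>x. f' x h)"
proof -
  obtain f' where f: "\<forall>x\<in>V. (f has_derivative blinfun_apply (f' x)) (at x)" "continuous_on V f'"
    using assms unfolding C1_on_def by auto
  show ?thesis
    by (rule that[of "\<lambda>x. blinfun_apply (f' x)"])
      (auto simp: f intro!: blinfun.continuous_on f continuous_on_const)
qed

lemma C1_on_imp_continuous_on: "C1_on V f \<Longrightarrow> continuous_on V f"
  unfolding C1_on_def
  by (meson continuous_at_imp_continuous_on has_derivative_continuous)

lemma C1_on_subset: "C1_on V f \<Longrightarrow> W \<subseteq> V \<Longrightarrow> C1_on W f"
  unfolding C1_on_def by (meson continuous_on_subset subsetD)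

lemma C2_on_subset: "C2_on V f \<Longrightarrow> W \<subseteq> V \<Longrightarrow> C2_on W f"
  unfolding C2_on_def by (meson C1_on_subset subsetD)

lemma C1_on_cong:
  assumes "open V" "\<And>x. x \<in> V \<Longrightarrow> f x = g x" "C1_on V g"
  shows "C1_on V f"
  using assms unfolding C1_on_def by (metis has_derivative_transform_within_open)

lemma C1_on_const: "C1_on V (\<lambda>x. c)"
  unfolding C1_on_def
  by (intro exI[of _ "\<lambda>_. 0"]) (auto simp: zero_blinfun.rep_eq)

lemma C1_on_bilinear:
  fixes f :: "'e::euclidean_space \<Rightarrow> 'a::real_normed_vector"
    and prod :: "'a \<Rightarrow> 'b::real_normed_vector \<Rightarrow> 'c::real_normed_vector"
  assumes "bounded_bilinear prod" "C1_on V f" "C1_on V g"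
  shows "C1_on V (\<lambda>x. prod (f x) (g x))"
proof -
  obtain f' where f: "\<And>x. x \<in> V \<Longrightarrow> (f has_derivative f' x) (at x)" "\<And>h. continuous_on V (\<lambda>x. f' x h)"
    using C1_onE[OF assms(2)] by blast
  obtain g' where g: "\<And>x. x \<in> V \<Longrightarrow> (g has_derivative g' x) (at x)" "\<And>h. continuous_on V (\<lambda>x. g' x h)"
    using C1_onE[OF assms(3)] by blast
  note cont = bounded_bilinear.continuous_on[OF assms(1)]
  show ?thesis
  proof (rule C1_onI)
    show "((\<lambda>x. prod (f x) (g x)) has_derivative (\<lambda>h. prod (f x) (g' x h) + prod (f' x h) (g x))) (at x)"
      if "x \<in> V" for x
      by (rule bounded_bilinear.FDERIV[OF assms(1) f(1)[OF that] g(1)[OF that]])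
    show "continuous_on V (\<lambda>x. prod (f x) (g' x h) + prod (f' x h) (g x))" for h
      by (intro continuous_on_add cont f g C1_on_imp_continuous_on assms)
  qed
qed

lemma C1_on_compose:
  fixes g :: "'e::euclidean_space \<Rightarrow> 'a::real_normed_vector"
  assumes "C1_on UNIV f" "C1_on V g"
  shows "C1_on V (\<lambda>x. f (g x))"
proof -
  obtain f' :: "'a \<Rightarrow> 'a \<Rightarrow>\<^sub>L _"
    where f: "\<And>x. (f has_derivative blinfun_apply (f' x)) (at x)" "continuous_on UNIV f'"
    using assms(1) unfolding C1_on_def by auto
  obtain g' where g: "\<And>x. x \<in> V \<Longrightarrow> (g has_derivative g' x) (at x)" "\<And>h. continuous_on V (\<lambda>x. g' x h)"
    using C1_onE[OF assms(2)] by blast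
  show ?thesis
  proof (rule C1_onI)
    show "((\<lambda>x. f (g x)) has_derivative (\<lambda>h. f' (g x) (g' x h))) (at x)" if "x \<in> V" for x
      using diff_chain_at[OF g(1)[OF that] f(1)] by (simp add: o_def)
    have "continuous_on V (\<lambda>x. f' (g x))"
      by (rule continuous_on_compose2[OF f(2) C1_on_imp_continuous_on[OF assms(2)]]) simp
    then show "continuous_on V (\<lambda>x. f' (g x) (g' x h))" for h
      by (intro blinfun.continuous_on g)
  qed
qed

lemma C1_on_bounded_linear: "bounded_linear f \<Longrightarrow> C1_on V f"
  unfolding C1_on_def
  by (intro exI[of _ "\<lambda>_. Blinfun f"])
    (auto simp: bounded_linear_Blinfun_apply bounded_linear_imp_has_derivative)

lemmas C1_on_linear_compose = C1_on_compose[OF C1_on_bounded_linear]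

lemma C1_on_add:
  assumes "C1_on V f" "C1_on V g"
  shows "C1_on V (\<lambda>x. f x + g x)"
proof -
  obtain f' g' where "\<forall>x\<in>V. (f has_derivative blinfun_apply (f' x)) (at x)" "continuous_on V f'"
    "\<forall>x\<in>V. (g has_derivative blinfun_apply (g' x)) (at x)" "continuous_on V g'"
    using assms unfolding C1_on_def by auto
  then show ?thesis
    unfolding C1_on_def
    by (intro exI[of _ "\<lambda>x. f' x + g' x"])
      (auto intro!: continuous_on_add has_derivative_add simp: plus_blinfun.rep_eq)
qed

lemma C1_on_sum: "(\<And>i. i \<in> I \<Longrightarrow> C1_on V (f i)) \<Longrightarrow> C1_on V (\<lambda>x. \<Sum>i\<in>I. f i x)"
  by (induction I rule: infinite_finite_induct) (auto intro: C1_on_const C1_on_add)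

lemma C1_on_prod:
  fixes f :: "'i \<Rightarrow> 'e::euclidean_space \<Rightarrow> real"
  shows "(\<And>i. i \<in> I \<Longrightarrow> C1_on V (f i)) \<Longrightarrow> C1_on V (\<lambda>x. \<Prod>i\<in>I. f i x)"
  by (induction I rule: infinite_finite_induct)
    (auto intro: C1_on_const C1_on_bilinear[OF bounded_bilinear_mult])

lemma C1_on_inverse:
  fixes f :: "'e::euclidean_space \<Rightarrow> real"
  assumes "C1_on V f" "\<And>x. x \<in> V \<Longrightarrow> f x \<noteq> 0"
  shows "C1_on V (\<lambda>x. inverse (f x))"
proof -
  obtain f' where f: "\<And>x. x \<in> V \<Longrightarrow> (f has_derivative f' x) (at x)" "\<And>h. continuous_on V (\<lambda>x. f' x h)"
    using C1_onE[OF assms(1)] by blast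
  show ?thesis
  proof (rule C1_onI)
    show "((\<lambda>x. inverse (f x)) has_derivative (\<lambda>h. - (inverse (f x) * f' x h * inverse (f x)))) (at x)"
      if "x \<in> V" for x
      by (rule Deriv.has_derivative_inverse[OF assms(2)[OF that] f(1)[OF that]])
    show "continuous_on V (\<lambda>x. - (inverse (f x) * f' x h * inverse (f x)))" for h
      using assms(2) by (intro continuous_intros f C1_on_imp_continuous_on[OF assms(1)]) auto
  qed
qed

lemma C1_on_det:
  fixes M :: "'e::euclidean_space \<Rightarrow> real^'m::finite^'m"
  assumes "\<And>i j. C1_on V (\<lambda>x. M x $ i $ j)"
  shows "C1_on V (\<lambda>x. det (M x))"
  unfolding det_def
  by (intro C1_on_sum C1_on_bilinear[OF bounded_bilinear_mult] C1_on_const C1_on_prod assms)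

text \<open>Cramer's rule for the Gram matrix expresses the coefficients rationally in inner products.\<close>

lemma C1_on_coefficients:
  fixes a :: "'m::finite \<Rightarrow> 'e::euclidean_space \<Rightarrow> 'h::real_inner" and c :: "'e \<Rightarrow> real^'m"
  assumes "open V" and a: "\<And>i. C1_on V (a i)" and b: "C1_on V b"
    and rep: "\<And>x. x \<in> V \<Longrightarrow> b x = (\<Sum>l\<in>UNIV. (c x $ l) *\<^sub>R a l x)"
    and indep: "\<And>x. x \<in> V \<Longrightarrow> inj (\<lambda>i. a i x) \<and> independent (range (\<lambda>i. a i x))"
  shows "C1_on V (\<lambda>x. c x $ k)"
proof -
  define Gr :: "'e \<Rightarrow> real^'m^'m" where "Gr x = (\<chi> i l. a i x \<bullet> a l x)" for x
  define r :: "'e \<Rightarrow> real^'m" where "r x = (\<chi> i. a i x \<bullet> b x)" for x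
  have det: "det (Gr x) \<noteq> 0" if x: "x \<in> V" for x
  proof -
    \<comment> \<open>Independence is that of the set of vectors \<open>a i x\<close>, with
      coefficients indexed by vectors; injectivity of the family translates these back to
      indices.\<close>
    have inv: "the_inv (\<lambda>i. a i x) (a i x) = i" for i
      using the_inv_f_f[of "\<lambda>i. a i x" i] indep[OF x] by simp
    have "v = 0" if v: "Gr x *v v = 0" for v
    proof -
      let ?s = "\<Sum>l\<in>UNIV. (v $ l) *\<^sub>R a l x"
      have "a i x \<bullet> ?s = (Gr x *v v) $ i" for i
        by (simp add: Gr_def matrix_vector_mult_def inner_sum_right mult.commute)
      \<comment> \<open>This is the quadratic form of the Gram matrix at \<open>v\<close>, which
        vanishes because \<open>v\<close> is in its kernel.\<close>
      then have 0: "?s \<bullet> ?s = 0"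
        using v by (subst inner_sum_left) simp
      have "(\<Sum>w\<in>range (\<lambda>i. a i x). v $ (the_inv (\<lambda>i. a i x) w) *\<^sub>R w) = ?s"
        using indep[OF x] by (subst sum.reindex) (auto simp: inv)
      with 0 have "(\<Sum>w\<in>range (\<lambda>i. a i x). v $ (the_inv (\<lambda>i. a i x) w) *\<^sub>R w) = 0"
        by simp
      then have "v $ (the_inv (\<lambda>i. a i x) (a i x)) = 0" for i
        by (rule independentD[OF conjunct2[OF indep[OF x]] finite_imageI[OF finite] subset_refl _ rangeI])
      then show "v = 0"
        by (simp add: inv vec_eq_iff)
    qed
    then show ?thesis
      by (metis invertible_det_nz invertible_left_inverse matrix_left_invertible_ker)
  qed
  have "Gr x *v c x = r x" if "x \<in> V" for x
    using rep[OF that] by (simp add: Gr_def r_def matrix_vector_mult_def inner_sum_right mult.commute)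
  then have c: "c x $ k = det (\<chi> i j. if j = k then r x $ i else Gr x $ i $ j) * inverse (det (Gr x))"
    if "x \<in> V" for x
    using cramer[OF det[OF that], of "c x" "r x"] that by (simp add: divide_inverse)
  have Gr: "C1_on V (\<lambda>x. Gr x $ i $ j)" and r: "C1_on V (\<lambda>x. r x $ i)" for i j
    by (auto simp: Gr_def r_def intro!: C1_on_bilinear[OF bounded_bilinear_inner] a b)
  have "C1_on V (\<lambda>x. (\<chi> i j. if j = k then r x $ i else Gr x $ i $ j) $ i $ j)" for i j
    by (cases "j = k") (auto intro: Gr r)
  then show ?thesis
    by (intro C1_on_cong[OF \<open>open V\<close> c] C1_on_bilinear[OF bounded_bilinear_mult] C1_on_det
        C1_on_inverse Gr det)
qed

section \<open>Second-order smoothness and partial derivatives\<close>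

lemma C2_onI:
  fixes f :: "real^'n::finite \<Rightarrow> 'b::real_normed_vector"
  assumes "\<And>x. x \<in> V \<Longrightarrow> (f has_derivative (\<lambda>h. \<Sum>i\<in>UNIV. (h $ i) *\<^sub>R g i x)) (at x)"
    and "\<And>i. C1_on V (g i)"
  shows "C2_on V f"
proof -
  \<comment> \<open>\<open>E i z\<close> is the operator sending \<open>h\<close> to
    \<open>h $ i *\<^sub>R z\<close>, and it is bounded linear in \<open>z\<close>. The derivative
    of \<open>f\<close> is the sum of the \<open>E i (g i x)\<close>, so it inherits class C1 in
    operator norm from the \<open>g i\<close>.\<close>
  define E :: "'n \<Rightarrow> 'b \<Rightarrow> (real^'n) \<Rightarrow>\<^sub>L 'b"
    where "E i z = blinfun_scaleR_left z o\<^sub>L Blinfun (\<lambda>h. h $ i)" for i z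
  have E: "blinfun_apply (E i z) h = h $ i *\<^sub>R z" for i z h
    by (simp add: E_def bounded_linear_Blinfun_apply bounded_linear_vec_nth)
  have "bounded_linear (E i)" for i
    unfolding E_def
    by (intro bounded_linear_compose[OF bounded_bilinear.bounded_linear_left[OF
          bounded_bilinear_blinfun_compose] bounded_linear_blinfun_scaleR_left])
  then have C1: "C1_on V (\<lambda>x. \<Sum>i\<in>UNIV. E i (g i x))"
    using assms(2) by (intro C1_on_sum) (rule C1_on_linear_compose)
  have "blinfun_apply (\<Sum>i\<in>UNIV. E i (g i x)) = (\<lambda>h. \<Sum>i\<in>UNIV. h $ i *\<^sub>R g i x)" for x
    by (rule ext) (simp add: blinfun.sum_left E)
  with C1 show ?thesis
    unfolding C2_on_def using assms(1)
    by (intro exI[of _ "\<lambda>x. \<Sum>i\<in>UNIV. E i (g i x)"]) simp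
qed

text \<open>Evaluation at a fixed \<open>h\<close> is bounded linear on operators, so the second
  claim follows from the operator-valued derivative being C1. That derivative is known to agree with
  \<open>frechet_derivative\<close> on \<open>V\<close> only; openness of \<open>V\<close> allows
  the transfer.\<close>

lemma C2_onD:
  fixes f :: "'e::euclidean_space \<Rightarrow> 'b::real_normed_vector"
  assumes "C2_on V f"
  shows "x \<in> V \<Longrightarrow> (f has_derivative frechet_derivative f (at x)) (at x)"
    and "open V \<Longrightarrow> C1_on V (\<lambda>x. frechet_derivative f (at x) h)"
proof -
  obtain f' :: "'e \<Rightarrow> 'e \<Rightarrow>\<^sub>L 'b"
    where f: "\<And>x. x \<in> V \<Longrightarrow> (f has_derivative blinfun_apply (f' x)) (at x)" "C1_on V f'"
    using assms unfolding C2_on_def by auto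
  have eq: "frechet_derivative f (at x) = blinfun_apply (f' x)" if "x \<in> V" for x
    using frechet_derivative_at[OF f(1)[OF that]] by simp
  then show "x \<in> V \<Longrightarrow> (f has_derivative frechet_derivative f (at x)) (at x)"
    using f by simp
  have "C1_on V (\<lambda>x. blinfun_apply (f' x) h)"
    by (rule C1_on_linear_compose[OF bounded_bilinear.bounded_linear_left[OF bounded_bilinear_blinfun_apply] f(2)])
  then show "open V \<Longrightarrow> C1_on V (\<lambda>x. frechet_derivative f (at x) h)"
    by (rule C1_on_cong[rotated 2]) (simp_all add: eq)
qed

lemma partial_derivative_eq:
  assumes "(f has_derivative f') (at x)"
  shows "partial_derivative i f x = f' (axis i 1)"
proof -
  have "((\<lambda>s. x + s *\<^sub>R axis i 1) has_derivative (\<lambda>s. s *\<^sub>R axis i 1)) (at (0::real))"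
    by (auto intro!: derivative_eq_intros)
  then have "((\<lambda>s. f (x + s *\<^sub>R axis i 1)) has_derivative (\<lambda>s. f' (s *\<^sub>R axis i 1))) (at 0)"
    using diff_chain_at[of "\<lambda>s. x + s *\<^sub>R axis i 1" _ "0::real" f f'] assms by (simp add: o_def)
  moreover have "f' (s *\<^sub>R axis i 1) = s *\<^sub>R f' (axis i 1)" for s
    using has_derivative_bounded_linear[OF assms] by (rule linear_scale[OF bounded_linear.linear])
  ultimately have "((\<lambda>s. f (x + s *\<^sub>R axis i 1)) has_vector_derivative f' (axis i 1)) (at 0)"
    by (simp add: has_vector_derivative_def)
  then show ?thesis
    unfolding partial_derivative_def by (rule vector_derivative_at)
qed

lemma linear_eq_sum_axis:
  fixes f :: "real^'n::finite \<Rightarrow> 'b::real_vector"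
  assumes "linear f"
  shows "f h = (\<Sum>i\<in>UNIV. h $ i *\<^sub>R f (axis i 1))"
  by (subst basis_expansion[symmetric])
    (simp add: linear_sum[OF assms] linear_scale[OF assms] scalar_mult_eq_scaleR)

section \<open>Orbits of multi-parameter groups\<close>

text \<open>By the Baire category theorem: the closed sets \<open>S n\<close> on which the family is
  bounded by \<open>n\<close> cover the space, so one of them contains a ball. Subtracting the
  bounds at two of its points bounds the family near 0.\<close>

lemma uniform_boundedness:
  fixes F :: "('a::banach \<Rightarrow> 'b::real_normed_vector) set"
  assumes bl: "\<And>f. f \<in> F \<Longrightarrow> bounded_linear f" and pt: "\<And>x. \<exists>C. \<forall>f\<in>F. norm (f x) \<le> C"
  obtains K where "K > 0" "\<And>f x. f \<in> F \<Longrightarrow> norm (f x) \<le> K * norm x"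
proof -
  define S where "S n = {x. \<forall>f\<in>F. norm (f x) \<le> real n}" for n
  have cl: "closed (S n)" for n
  proof -
    have "S n = (\<Inter>f\<in>F. {x. norm (f x) \<le> real n})"
      by (auto simp: S_def)
    moreover have "closed {x. norm (f x) \<le> real n}" if "f \<in> F" for f
      using linear_continuous_on[OF bl[OF that], of UNIV]
      by (intro closed_Collect_le continuous_intros) auto
    ultimately show ?thesis by (simp add: closed_INT)
  qed
  have un: "\<Union>(range S) = UNIV"
  proof -
    have "\<exists>n. x \<in> S n" for x
    proof -
      obtain C where "\<forall>f\<in>F. norm (f x) \<le> C" using pt by blast
      moreover obtain n where "C \<le> real n" using real_arch_simple by blast
      ultimately have "x \<in> S n" unfolding S_def by fastforce
      then show ?thesis ..
    qed
    then show ?thesis by auto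
  qed
  have "\<exists>n. interior (S n) \<noteq> {}"
  proof (rule ccontr)
    assume "\<not> ?thesis"
    then have "euclidean interior_of \<Union>(range S) = {}"
      by (intro Baire_category_alt) (auto simp: completely_metrizable_space_euclidean cl)
    then show False
      unfolding un by (simp add: interior_UNIV)
  qed
  then obtain n x0 r where r: "r > 0" "ball x0 r \<subseteq> S n"
    by (auto simp: mem_interior)
  show ?thesis
  proof (rule that[of "4 * real n / r + 1"])
    show "4 * real n / r + 1 > 0" using r by (auto intro!: add_nonneg_pos)
    fix f x assume f: "f \<in> F"
    interpret bounded_linear f by (rule bl[OF f])
    show "norm (f x) \<le> (4 * real n / r + 1) * norm x"
    proof (cases "x = 0")
      case False
      \<comment> \<open>Rescaling \<open>x\<close> to length \<open>r / 2\<close> keeps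
        \<open>x0 + y\<close> in the ball, which gives the factor \<open>4 * n / r\<close>. The
        added 1 in the bound keeps it positive when \<open>n = 0\<close>.\<close>
      define y where "y = (r / (2 * norm x)) *\<^sub>R x"
      have "norm y < r" using r False by (simp add: y_def)
      then have "x0 + y \<in> S n" "x0 \<in> S n"
        using r by (auto simp: dist_norm)
      then have "norm (f (x0 + y)) \<le> n" "norm (f x0) \<le> n"
        using f by (auto simp: S_def)
      then have "norm (f y) \<le> 2 * n"
        using norm_triangle_ineq4[of "f (x0 + y)" "f x0"] by (simp add: add)
      then have "norm (f x) \<le> 4 * n / r * norm x"
        using r False by (simp add: y_def scaleR field_simps)
      then show ?thesis
        by (simp add: distrib_right add_increasing2)
    qed (simp add: zero)
  qed
qed

lemma C0_groupD:
  assumes "C0_group T"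
  shows "bounded_linear (T t)" and "T 0 x = x" and "T (t + s) x = T t (T s x)"
    and "continuous_on UNIV (\<lambda>t. T t x)"
  using assms unfolding C0_group_def by auto

text \<open>Strong continuity bounds every single orbit over the compact ball of parameters; uniform
  boundedness turns this into one operator bound.\<close>

lemma C0_group_locally_bounded:
  fixes T :: "real^'d::finite \<Rightarrow> 'h::banach \<Rightarrow> 'h"
  assumes "C0_group T"
  obtains K where "K > 0" "\<And>t x. dist t a \<le> 1 \<Longrightarrow> norm (T t x) \<le> K * norm x"
proof -
  have "\<exists>C. \<forall>f\<in>T ` cball a 1. norm (f x) \<le> C" for x
  proof -
    have "bounded ((\<lambda>t. T t x) ` cball a 1)"
      using C0_groupD(4)[OF assms]
      by (intro compact_imp_bounded compact_continuous_image) (auto intro: continuous_on_subset)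
    then show ?thesis by (auto simp: bounded_iff)
  qed
  then obtain K where K: "K > 0" "\<And>f x. f \<in> T ` cball a 1 \<Longrightarrow> norm (f x) \<le> K * norm x"
    using uniform_boundedness[of "T ` cball a 1"] C0_groupD(1)[OF assms] by blast
  then show ?thesis
    by (intro that[of K]) (auto simp: dist_commute)
qed

text \<open>The scalar factor vanishes at \<open>a\<close>, so continuity of \<open>c\<close> there
  suffices. It is meant for \<open>c\<close> of the form \<open>T (u x) (g' b)\<close>, which is
  known only to be continuous at \<open>a\<close>.\<close>

lemma has_derivative_scaleR_vanishing:
  fixes c :: "'a::real_inner \<Rightarrow> 'b::real_normed_vector"
  assumes "isCont c a"
  shows "((\<lambda>x. ((x - a) \<bullet> b) *\<^sub>R c x) has_derivative (\<lambda>h. (h \<bullet> b) *\<^sub>R c a)) (at a)"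
proof (rule has_derivativeI_sandwich[where e = 1])
  show "bounded_linear (\<lambda>h. (h \<bullet> b) *\<^sub>R c a)"
    by (intro bounded_linear_scaleR_const bounded_linear_inner_left)
  show "((\<lambda>x. norm b * norm (c x - c a)) \<longlongrightarrow> 0) (at a)"
    using assms by (intro tendsto_mult_right_zero tendsto_norm_zero) (simp add: isCont_def LIM_zero)
  fix x assume "x \<noteq> a"
  have "norm (((x - a) \<bullet> b) *\<^sub>R c x - ((a - a) \<bullet> b) *\<^sub>R c a - ((x - a) \<bullet> b) *\<^sub>R c a)
      = \<bar>(x - a) \<bullet> b\<bar> * norm (c x - c a)"
    by (simp flip: scaleR_diff_right)
  also have "\<dots> \<le> norm (x - a) * norm b * norm (c x - c a)"
    by (intro mult_right_mono Cauchy_Schwarz_ineq2) simp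
  finally show "norm (((x - a) \<bullet> b) *\<^sub>R c x - ((a - a) \<bullet> b) *\<^sub>R c a - ((x - a) \<bullet> b) *\<^sub>R c a) / norm (x - a)
      \<le> norm b * norm (c x - c a)"
    using \<open>x \<noteq> a\<close> by (simp add: divide_le_eq mult_ac)
qed simp

text \<open>A product rule: \<open>T\<close> is only strongly continuous, so local boundedness controls the remainder
  of \<open>g\<close>, and strong continuity suffices for its differential because the domain is
  finite-dimensional.\<close>

lemma C0_group_has_derivative:
  fixes T :: "real^'d::finite \<Rightarrow> 'h::banach \<Rightarrow> 'h" and g :: "'e::euclidean_space \<Rightarrow> 'h"
  assumes T: "C0_group T" and g: "(g has_derivative g') (at a)" and u: "isCont u a"
    and D: "((\<lambda>x. T (u x) (g a)) has_derivative D) (at a)"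
  shows "((\<lambda>x. T (u x) (g x)) has_derivative (\<lambda>h. T (u a) (g' h) + D h)) (at a)"
proof -
  define r where "r x = g x - g a - g' (x - a)" for x
  have lin: "linear (T t)" for t
    using C0_groupD(1)[OF T] by (rule bounded_linear.linear)
  have lg: "linear g'"
    using has_derivative_bounded_linear[OF g] by (rule bounded_linear.linear)
  have g'_sum: "g' h = (\<Sum>b\<in>Basis. (h \<bullet> b) *\<^sub>R g' b)" for h
    using linear_sum[OF lg, of "\<lambda>b. (h \<bullet> b) *\<^sub>R b" Basis]
    by (simp add: euclidean_representation linear_scale[OF lg])
  obtain K where K: "K > 0" "\<And>t x. dist t (u a) \<le> 1 \<Longrightarrow> norm (T t x) \<le> K * norm x"
    using C0_group_locally_bounded[OF T] by blast
  obtain d where d: "d > 0" "\<And>x. dist x a < d \<Longrightarrow> dist (u x) (u a) < 1"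
    using u unfolding continuous_at_eps_delta by (metis zero_less_one)
  have 2: "((\<lambda>x. T (u x) (r x)) has_derivative (\<lambda>h. 0)) (at a)"
  proof (rule has_derivativeI_sandwich[where e = d])
    have "((\<lambda>y. norm (g y - g a - g' (y - a)) / norm (y - a)) \<longlongrightarrow> 0) (at a)"
      using g unfolding has_derivative_iff_norm by blast
    then show "((\<lambda>x. K * (norm (r x) / norm (x - a))) \<longlongrightarrow> 0) (at a)"
      unfolding r_def by (rule tendsto_mult_right_zero)
    fix x assume "x \<noteq> a" "dist x a < d"
    then have "norm (T (u x) (r x)) \<le> K * norm (r x)"
      using d K by (meson less_imp_le)
    moreover have "r a = 0" by (simp add: r_def linear_0[OF lg])
    ultimately show "norm (T (u x) (r x) - T (u a) (r a) - 0) / norm (x - a) \<le> K * (norm (r x) / norm (x - a))"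
      by (simp add: linear_0[OF lin] divide_right_mono)
  qed (use d in auto)
  have "isCont (\<lambda>x. T (u x) y) a" for y
    using continuous_at_compose[OF u, of "\<lambda>t. T t y"] C0_groupD(4)[OF T, of y]
    by (simp add: continuous_on_eq_continuous_at o_def)
  then have 3: "((\<lambda>x. \<Sum>b\<in>Basis. ((x - a) \<bullet> b) *\<^sub>R T (u x) (g' b)) has_derivative
      (\<lambda>h. \<Sum>b\<in>Basis. (h \<bullet> b) *\<^sub>R T (u a) (g' b))) (at a)"
    by (intro has_derivative_sum has_derivative_scaleR_vanishing)
  have T_sum: "T t (g' h) = (\<Sum>b\<in>Basis. (h \<bullet> b) *\<^sub>R T t (g' b))" for t h
    by (subst g'_sum) (simp add: linear_sum[OF lin] linear_scale[OF lin])
  \<comment> \<open>Three summands: a frozen vector moved by \<open>T\<close>, with derivative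
    \<open>D\<close> by hypothesis; the remainder, with derivative 0; the differential of
    \<open>g\<close>, expanded over the basis.\<close>
  have "T (u x) (g x) = T (u x) (g a) + T (u x) (r x) + T (u x) (g' (x - a))" for x
    by (simp add: r_def flip: linear_add[OF lin])
  then show ?thesis
    using has_derivative_add[OF has_derivative_add[OF D 2] 3]
    by (simp add: add.commute flip: T_sum)
qed

section \<open>Generators and smoothness of orbits\<close>

lemma generator_has_derivative:
  assumes T: "C0_group T" and "x \<in> generator_dom T"
  shows "((\<lambda>s. T (s *\<^sub>R axis i 1) x) has_derivative (\<lambda>s. s *\<^sub>R generator T i x)) (at 0)"
proof -
  obtain z where z: "((\<lambda>h. (T (h *\<^sub>R axis i 1) x - x) /\<^sub>R h) \<longlongrightarrow> z) (at 0)"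
    using assms(2) unfolding generator_dom_def generator_dom1_def by auto
  then have eq: "generator T i x = z"
    unfolding generator_def generator1_def by (intro tendsto_Lim) auto
  have "((\<lambda>h. norm ((T (h *\<^sub>R axis i 1) x - x) /\<^sub>R h - z)) \<longlongrightarrow> 0) (at 0)"
    using z by (intro tendsto_norm_zero LIM_zero)
  then have "((\<lambda>h. norm (T (h *\<^sub>R axis i 1) x - x - h *\<^sub>R z) / norm h) \<longlongrightarrow> 0) (at 0)"
  proof (rule Lim_transform_eventually)
    show "\<forall>\<^sub>F h in at 0. norm ((T (h *\<^sub>R axis i 1) x - x) /\<^sub>R h - z)
        = norm (T (h *\<^sub>R axis i 1) x - x - h *\<^sub>R z) / norm h"
    proof (rule eventually_mono[OF eventually_neq_at_within])
      fix h :: real assume "h \<noteq> 0"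
      then have "(T (h *\<^sub>R axis i 1) x - x) /\<^sub>R h - z = (T (h *\<^sub>R axis i 1) x - x - h *\<^sub>R z) /\<^sub>R h"
        by (simp add: scaleR_diff_right)
      then show "norm ((T (h *\<^sub>R axis i 1) x - x) /\<^sub>R h - z)
          = norm (T (h *\<^sub>R axis i 1) x - x - h *\<^sub>R z) / norm h"
        by (simp add: divide_inverse mult.commute)
    qed
  qed
  then show ?thesis
    by (simp add: eq has_derivative_iff_norm bounded_linear_scaleR_left C0_groupD(2)[OF T])
qed

text \<open>Differentiability at 0 is built one coordinate at a time: the group law splits off the
  factor \<open>T (h $ k *\<^sub>R axis k 1)\<close>, and the product rule adds the term of
  \<open>k\<close>. The group law then carries the result from 0 to \<open>t\<close>.\<close>

lemma orbit_has_derivative: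
  fixes T :: "real^'d::finite \<Rightarrow> 'h::banach \<Rightarrow> 'h"
  assumes T: "C0_group T" and x: "x \<in> generator_dom T"
  shows "((\<lambda>t. T t x) has_derivative (\<lambda>h. \<Sum>k\<in>UNIV. h $ k *\<^sub>R T t (generator T k x))) (at t)"
proof -
  let ?s = "\<lambda>S (h :: real^'d). \<Sum>k\<in>S. h $ k *\<^sub>R axis k 1"
  have 0: "((\<lambda>h. T (?s S h) x) has_derivative (\<lambda>h. \<Sum>k\<in>S. h $ k *\<^sub>R generator T k x)) (at 0)"
    if "finite S" for S
    using that
  proof induction
    case empty
    then show ?case by simp
  next
    case (insert k S)
    have nth: "((\<lambda>h :: real^'d. h $ k) has_derivative (\<lambda>h. h $ k)) (at 0)"
      by (rule bounded_linear_imp_has_derivative[OF bounded_linear_vec_nth])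
    have "((\<lambda>h. T (h $ k *\<^sub>R axis k 1) x) has_derivative (\<lambda>h. h $ k *\<^sub>R generator T k x)) (at 0)"
      using diff_chain_at[OF nth, of "\<lambda>s. T (s *\<^sub>R axis k 1) x"] generator_has_derivative[OF T x, of k]
      by (simp add: o_def)
    \<comment> \<open>Product rule at 0 with \<open>u h = h $ k *\<^sub>R axis k 1\<close> and
      \<open>g h = T (?s S h) x\<close>; since \<open>g 0 = x\<close>, the fact just shown supplies
      \<open>D\<close>.\<close>
    then have "((\<lambda>h. T (h $ k *\<^sub>R axis k 1) (T (?s S h) x)) has_derivative
        (\<lambda>h. T ((0::real^'d) $ k *\<^sub>R axis k 1) (\<Sum>k\<in>S. h $ k *\<^sub>R generator T k x)
          + h $ k *\<^sub>R generator T k x)) (at 0)"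
      by (intro C0_group_has_derivative[OF T insert.IH])
        (auto simp: C0_groupD(2)[OF T] intro!: continuous_intros)
    then show ?case
      using insert.hyps by (simp add: C0_groupD(2,3)[OF T] add.commute flip: C0_groupD(3)[OF T])
  qed
  have "?s UNIV h = h" for h
    using basis_expansion[of h] by (simp add: scalar_mult_eq_scaleR)
  \<comment> \<open>Writing the base point 0 as \<open>t - t\<close> lets the chain rule apply to
    the shift \<open>s - t\<close>.\<close>
  with 0[of UNIV] have "((\<lambda>h. T h x) has_derivative (\<lambda>h. \<Sum>k\<in>UNIV. h $ k *\<^sub>R generator T k x)) (at (t - t))"
    by simp
  then have "((\<lambda>s. T (s - t) x) has_derivative (\<lambda>h. \<Sum>k\<in>UNIV. h $ k *\<^sub>R generator T k x)) (at t)"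
    using diff_chain_at[of "\<lambda>s. s - t" "\<lambda>h. h" t "\<lambda>s. T s x"]
    by (simp add: o_def has_derivative_diff[OF has_derivative_ident has_derivative_const, simplified])
  from bounded_linear.has_derivative[OF C0_groupD(1)[OF T, of t] this]
  show ?thesis
    using C0_groupD(1)[OF T, of t]
    by (simp add: linear_sum linear_scale bounded_linear.linear flip: C0_groupD(3)[OF T])
qed

text \<open>The partial derivatives of the orbit are the orbits of the points
  \<open>generator T k x\<close>. For \<open>x\<close> in the domain of the squared generator these
  points lie again in the domain, so the first-order result applies twice.\<close>

lemma orbit_C2:
  fixes T :: "real^'d::finite \<Rightarrow> 'h::banach \<Rightarrow> 'h"
  assumes T: "C0_group T" and x: "x \<in> generator_dom2 T"
  shows "C2_on UNIV (\<lambda>t. T t x)"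
proof (rule C2_onI)
  show "((\<lambda>t. T t x) has_derivative (\<lambda>h. \<Sum>k\<in>UNIV. h $ k *\<^sub>R T t (generator T k x))) (at t)" for t
    using x by (intro orbit_has_derivative T) (auto simp: generator_dom2_def)
  show "C1_on UNIV (\<lambda>t. T t (generator T k x))" for k
  proof (rule C1_onI)
    show "((\<lambda>t. T t (generator T k x)) has_derivative
        (\<lambda>h. \<Sum>l\<in>UNIV. h $ l *\<^sub>R T t (generator T l (generator T k x)))) (at t)" for t
      using x by (intro orbit_has_derivative T) (auto simp: generator_dom2_def)
    show "continuous_on UNIV (\<lambda>t. \<Sum>l\<in>UNIV. h $ l *\<^sub>R T t (generator T l (generator T k x)))" for h
      by (intro continuous_intros C0_groupD(4)[OF T])
  qed
qed

section \<open>Submanifolds induced by an orbit map\<close>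

text \<open>With a left inverse \<open>Q\<close> of \<open>R\<close>, the map \<open>P = id - R \<circ> Q\<close> kills the range of \<open>R\<close>. Since \<open>R\<close> is injective,
  \<open>z x - z b\<close> is controlled by \<open>f x - f b\<close>, so \<open>P \<circ> f\<close> has derivative \<open>0\<close> at \<open>b\<close>, although \<open>z\<close> is
  merely continuous.\<close>

lemma range_derivative_subset:
  fixes p :: "'a::euclidean_space \<Rightarrow> 'b::euclidean_space" and f :: "'c::euclidean_space \<Rightarrow> 'b"
  assumes p: "(p has_derivative R) (at (z b))" and "inj R" and f: "(f has_derivative D) (at b)"
    and z: "isCont z b" and S: "open S" "b \<in> S" "\<And>x. x \<in> S \<Longrightarrow> f x = p (z x)"
  shows "range D \<subseteq> range R"
proof -
  have R: "linear R" and D: "linear D"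
    using p f by (auto dest: has_derivative_bounded_linear bounded_linear.linear)
  obtain Q where Q: "linear Q" "Q \<circ> R = id"
    using linear_injective_left_inverse[OF R \<open>inj R\<close>] by blast
  define P where "P y = y - R (Q y)" for y
  have P: "linear P"
    unfolding P_def using linear_compose_sub[OF linear_id linear_compose[OF Q(1) R]] by (simp add: o_def id_def)
  have QR: "Q (R w) = w" for w
    using Q(2) by (metis comp_apply id_apply)
  have PR: "P (R w) = 0" for w
    by (simp add: P_def QR)
  obtain K where K: "K > 0" "\<And>y. norm (Q y) \<le> K * norm y"
    using linear_bounded_pos[OF Q(1)] by blast
  obtain L where L: "L > 0" "\<And>y. norm (P y) \<le> L * norm y"
    using linear_bounded_pos[OF P] by blast
  obtain M where M: "M > 0" "\<And>h. norm (D h) \<le> M * norm h"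
    using linear_bounded_pos[OF D] by blast
  have "((\<lambda>x. P (f x)) has_derivative (\<lambda>h. 0)) (at b)"
    unfolding has_derivative_at_alt
  proof (intro conjI allI impI)
    fix e :: real assume "e > 0"
    \<comment> \<open>The first entry lets half of \<open>norm (z x - z b)\<close> be absorbed
      below; the second is \<open>e\<close> divided by the constants that the final estimate
      accumulates.\<close>
    define \<epsilon> where "\<epsilon> = min (1 / (2 * K)) (e / (L * 2 * K * (M + 1)))"
    have \<epsilon>: "\<epsilon> > 0" "K * \<epsilon> \<le> 1 / 2" "L * \<epsilon> * (2 * K * (M + 1)) \<le> e"
    proof -
      show "\<epsilon> > 0" using K L M \<open>e > 0\<close> by (simp add: \<epsilon>_def)
      have "K * \<epsilon> \<le> K * (1 / (2 * K))" using K by (intro mult_left_mono) (auto simp: \<epsilon>_def)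
      then show "K * \<epsilon> \<le> 1 / 2" using K by simp
      have "\<epsilon> * (L * 2 * K * (M + 1)) \<le> e / (L * 2 * K * (M + 1)) * (L * 2 * K * (M + 1))"
        using K L M by (intro mult_right_mono) (auto simp: \<epsilon>_def)
      then show "L * \<epsilon> * (2 * K * (M + 1)) \<le> e"
        using K L M by (simp add: mult_ac)
    qed
    obtain d1 where d1: "d1 > 0" "\<And>y. norm (y - z b) < d1 \<Longrightarrow> norm (p y - p (z b) - R (y - z b)) \<le> \<epsilon> * norm (y - z b)"
      using p \<epsilon>(1) unfolding has_derivative_at_alt by blast
    obtain d2 where d2: "d2 > 0" "\<And>x. norm (x - b) < d2 \<Longrightarrow> norm (z x - z b) < d1"
      using z d1(1) unfolding continuous_at_eps_delta dist_norm by blast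
    obtain d3 where d3: "d3 > 0" "\<And>x. norm (x - b) < d3 \<Longrightarrow> norm (f x - f b - D (x - b)) \<le> 1 * norm (x - b)"
      using f zero_less_one unfolding has_derivative_at_alt by blast
    obtain d4 where d4: "d4 > 0" "\<And>x. norm (x - b) < d4 \<Longrightarrow> x \<in> S"
      using S unfolding open_dist dist_norm by blast
    show "\<exists>d>0. \<forall>y. norm (y - b) < d \<longrightarrow> norm (P (f y) - P (f b) - 0) \<le> e * norm (y - b)"
    proof (intro exI[of _ "min d2 (min d3 d4)"] conjI allI impI)
      show "0 < min d2 (min d3 d4)" using d2 d3 d4 by simp
      fix x assume "norm (x - b) < min d2 (min d3 d4)"
      then have "norm (x - b) < d2" "norm (x - b) < d3" "norm (x - b) < d4" by auto
      have fx: "f x = p (z x)" "f b = p (z b)"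
        using S d4(2) \<open>norm (x - b) < d4\<close> by auto
      define r where "r = f x - f b - R (z x - z b)"
      have r: "norm r \<le> \<epsilon> * norm (z x - z b)"
        using d1(2)[OF d2(2)] \<open>norm (x - b) < d2\<close> by (simp add: r_def fx)
      \<comment> \<open>Applying the left inverse to \<open>f x - f b = R (z x - z b) + r\<close>
        recovers the increment of \<open>z\<close>; this upgrades continuity of \<open>z\<close> to
        a linear bound in \<open>f x - f b\<close>.\<close>
      have "z x - z b = Q (f x - f b) - Q r"
        by (simp add: r_def linear_diff[OF Q(1)] linear_diff[OF R] QR)
      then have "norm (z x - z b) \<le> K * norm (f x - f b) + K * norm r"
        using norm_triangle_ineq4 K(2) add_mono order_trans by metis
      also have "K * norm r \<le> K * \<epsilon> * norm (z x - z b)"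
        using r K(1) by (simp add: mult.assoc)
      also have "\<dots> \<le> 1 / 2 * norm (z x - z b)"
        using \<epsilon>(2) by (intro mult_right_mono) auto
      finally have zx: "norm (z x - z b) \<le> 2 * K * norm (f x - f b)" by simp
      have "norm (f x - f b) \<le> norm (f x - f b - D (x - b)) + norm (D (x - b))"
        using norm_triangle_ineq[of "f x - f b - D (x - b)" "D (x - b)"] by simp
      also have "\<dots> \<le> (M + 1) * norm (x - b)"
        using d3(2)[OF \<open>norm (x - b) < d3\<close>] M(2)[of "x - b"] by (simp add: distrib_right)
      finally have fxb: "norm (f x - f b) \<le> (M + 1) * norm (x - b)" .
      have "P (f x) - P (f b) - 0 = P r"
        by (simp add: r_def linear_diff[OF P] PR)
      then have "norm (P (f x) - P (f b) - 0) \<le> L * norm r"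
        using L(2) by simp
      also have "\<dots> \<le> L * (\<epsilon> * (2 * K * ((M + 1) * norm (x - b))))"
      proof -
        have "norm r \<le> \<epsilon> * (2 * K * norm (f x - f b))"
          using r zx \<epsilon>(1) by (meson mult_left_mono order_trans less_imp_le)
        also have "\<dots> \<le> \<epsilon> * (2 * K * ((M + 1) * norm (x - b)))"
          using fxb \<epsilon>(1) K(1) by (intro mult_left_mono) auto
        finally show ?thesis using L(1) by simp
      qed
      also have "\<dots> = L * \<epsilon> * (2 * K * (M + 1)) * norm (x - b)" by simp
      also have "\<dots> \<le> e * norm (x - b)"
        using \<epsilon>(3) by (intro mult_right_mono) auto
      finally show "norm (P (f x) - P (f b) - 0) \<le> e * norm (x - b)" .
    qed
  qed simp
  moreover have "((\<lambda>x. P (f x)) has_derivative (\<lambda>h. P (D h))) (at b)"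
    by (rule bounded_linear.has_derivative[OF linear_conv_bounded_linear[THEN iffD1, OF P] f])
  ultimately have "P (D h) = 0" for h
    using has_derivative_unique by metis
  \<comment> \<open>\<open>P (D h) = 0\<close> reads \<open>D h = R (Q (D h))\<close>.\<close>
  then show ?thesis
    by (auto simp: P_def)
qed

text \<open>\<open>tangent_space\<close> collects the derivatives of every C1 parametrization
  \<open>f\<close> of \<open>N\<close>. Any such \<open>f\<close> equals
  \<open>p \<circ> (g \<circ> f)\<close>, where \<open>g \<circ> f\<close> is only known to be
  continuous, which is the situation of \<open>range_derivative_subset\<close>.\<close>

lemma tangent_space_subset:
  fixes p :: "real^'m::finite \<Rightarrow> real^'d::finite"
  assumes hom: "homeomorphism W N p g" and "x \<in> W"
    and p: "(p has_derivative p') (at x)" "inj p'"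
  shows "tangent_space TYPE('m) N (p x) \<subseteq> range p'"
proof
  fix v assume "v \<in> tangent_space TYPE('m) N (p x)"
  then obtain U V and f :: "real^'m \<Rightarrow> real^'d" and b where f: "local_parametrization C1_on U V N f"
    and b: "b \<in> V" "f b = p x" and v: "v \<in> range (frechet_derivative f (at b))"
    unfolding tangent_space_def by blast
  obtain g' where g': "homeomorphism V (U \<inter> N) f g'" and "open V" and C1: "C1_on V f"
    using f unfolding local_parametrization_def by blast
  have "(f has_derivative frechet_derivative f (at b)) (at b)"
    using C1 b(1) unfolding C1_on_def by (metis frechet_derivative_works differentiableI)
  moreover have "f ` V \<subseteq> N" "continuous_on V f" "continuous_on N g"
    using g' hom by (auto simp: homeomorphism_def)
  then have "continuous_on V (\<lambda>y. g (f y))"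
    using continuous_on_compose2[of N g V f] by simp
  then have "isCont (\<lambda>y. g (f y)) b"
    using b \<open>open V\<close> continuous_on_eq_continuous_at by blast
  moreover have "g (f b) = x"
    using b hom \<open>x \<in> W\<close> by (simp add: homeomorphism_apply1)
  moreover have "f y = p (g (f y))" if "y \<in> V" for y
    using homeomorphism_apply2[OF hom] \<open>f ` V \<subseteq> N\<close> that by auto
  ultimately have "range (frechet_derivative f (at b)) \<subseteq> range p'"
    using p \<open>open V\<close> b by (intro range_derivative_subset[of p p' "\<lambda>y. g (f y)" b f _ V]) auto
  with v show "v \<in> range p'" by blast
qed

lemma C2_submanifoldI:
  fixes q :: "real^'m::finite \<Rightarrow> 'h::real_normed_vector"
  assumes "open W" "C2_on W q" "homeomorphism W M q g" "\<And>x. x \<in> W \<Longrightarrow> inj (frechet_derivative q (at x))"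
  shows "C2_submanifold TYPE('m) M"
  unfolding C2_submanifold_def
  by (intro ballI exI[of _ UNIV] exI[of _ W] exI[of _ q])
    (use assms in \<open>auto simp: local_parametrization_def\<close>)

text \<open>By the chain rule the derivative of \<open>q\<close> is that of \<open>\<psi>\<close>
  after that of \<open>p\<close>. Injectivity of the composite makes the inner map injective and the
  outer one injective on the inner range. Likewise the inverse \<open>g\<close> of \<open>q\<close>
  yields the inverses \<open>g \<circ> \<psi>\<close> of \<open>p\<close> and
  \<open>p \<circ> g\<close> of \<open>\<psi>\<close>.\<close>

lemma induced_by_factorization:
  fixes q :: "real^'m::finite \<Rightarrow> 'h::real_normed_vector" and p :: "real^'m \<Rightarrow> real^'d::finite"
  assumes W: "open W" and q: "C2_on W q" "homeomorphism W M q g"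
    and inj: "\<And>x. x \<in> W \<Longrightarrow> inj (frechet_derivative q (at x))"
    and p: "C2_on W p" and \<psi>: "C2_on UNIV \<psi>" and eq: "\<And>x. x \<in> W \<Longrightarrow> q x = \<psi> (p x)"
  shows "C2_submanifold TYPE('m) (p ` W) \<and> induced_by TYPE('m) M \<psi> (p ` W)"
proof -
  let ?p' = "\<lambda>x. frechet_derivative p (at x)" and ?\<psi>' = "\<lambda>t. frechet_derivative \<psi> (at t)"
  have chain: "frechet_derivative q (at x) = ?\<psi>' (p x) \<circ> ?p' x" if x: "x \<in> W" for x
  proof -
    have "(\<psi> \<circ> p has_derivative ?\<psi>' (p x) \<circ> ?p' x) (at x)"
      using x by (intro diff_chain_at C2_onD(1)[OF p] C2_onD(1)[OF \<psi>]) auto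
    then have "(q has_derivative ?\<psi>' (p x) \<circ> ?p' x) (at x)"
      by (rule has_derivative_transform_within_open[OF _ W x]) (simp add: eq)
    then show ?thesis by (rule frechet_derivative_at[symmetric])
  qed
  have cont_p: "continuous_on W p" and cont_\<psi>: "continuous_on UNIV \<psi>"
    using C2_onD(1)[OF p] C2_onD(1)[OF \<psi>]
    by (meson continuous_at_imp_continuous_on has_derivative_continuous UNIV_I)+
  have g: "continuous_on M g" "q ` W = M" "g ` M = W" "\<And>x. x \<in> W \<Longrightarrow> g (q x) = x" "\<And>y. y \<in> M \<Longrightarrow> q (g y) = y"
    using q(2) by (auto simp: homeomorphism_def)
  have \<psi>p: "\<psi> (p x) = q x" if "x \<in> W" for x
    using eq[OF that] by simp
  have M: "\<psi> ` p ` W = M"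
    using g(2) eq by (force simp: image_image)
  have hom_p: "homeomorphism W (p ` W) p (\<lambda>t. g (\<psi> t))"
  proof (rule homeomorphismI)
    show "continuous_on (p ` W) (\<lambda>t. g (\<psi> t))"
      using M by (intro continuous_on_compose2[OF g(1)] continuous_on_subset[OF cont_\<psi>]) auto
  qed (use cont_p g(2-5) \<psi>p in auto)
  have hom_\<psi>: "homeomorphism (p ` W) M \<psi> (\<lambda>y. p (g y))"
  proof (rule homeomorphismI)
    show "continuous_on M (\<lambda>y. p (g y))"
      using g by (intro continuous_on_compose2[OF cont_p]) auto
    show "continuous_on (p ` W) \<psi>"
      using cont_\<psi> by (rule continuous_on_subset) simp
  qed (use g(2-5) M \<psi>p in auto)
  have inj_p: "inj (?p' x)" if "x \<in> W" for x
    using inj[OF that] unfolding chain[OF that] by (rule inj_on_imageI2)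
  \<comment> \<open>The composite gives injectivity only on the range of the derivative of
    \<open>p\<close>, so the tangent space has to be placed inside that range.\<close>
  have "inj_on (?\<psi>' (p x)) (tangent_space TYPE('m) (p ` W) (p x))" if x: "x \<in> W" for x
  proof (rule inj_on_subset)
    show "tangent_space TYPE('m) (p ` W) (p x) \<subseteq> range (?p' x)"
      using x by (intro tangent_space_subset[OF hom_p] C2_onD(1)[OF p] inj_p)
    show "inj_on (?\<psi>' (p x)) (range (?p' x))"
      using inj[OF x] unfolding chain[OF x] by (rule inj_on_imageI)
  qed
  moreover have "C2_submanifold TYPE('m) (p ` W)"
    using W p hom_p inj_p by (rule C2_submanifoldI)
  moreover have "C2_submanifold TYPE('m) M"
    using W q inj by (rule C2_submanifoldI)
  ultimately show ?thesis
    using \<psi> hom_\<psi> M unfolding induced_by_def by auto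
qed

section \<open>Primitives and the factorization through an orbit\<close>

lemma primitive_on_has_derivative:
  assumes "primitive_on V \<Phi> p" "x \<in> V"
  shows "(p has_derivative (\<lambda>h. \<Sum>i\<in>UNIV. h $ i *\<^sub>R \<Phi> x $ i)) (at x)"
proof -
  obtain p' where p: "(p has_derivative p') (at x)"
    using assms unfolding primitive_on_def C1_on_def by blast
  \<comment> \<open>\<open>\<Phi>\<close> is the transposed Jacobian: its row \<open>i\<close> is
    the partial derivative of \<open>p\<close> in direction \<open>i\<close>.\<close>
  have "p' (axis i 1) = \<Phi> x $ i" for i
  proof -
    have "((\<lambda>z. p z $ k) has_derivative (\<lambda>h. p' h $ k)) (at x)" for k
      by (rule bounded_linear.has_derivative[OF bounded_linear_vec_nth p])
    from partial_derivative_eq[OF this] show ?thesis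
      using assms by (simp add: primitive_on_def vec_eq_iff)
  qed
  moreover have "p' h = (\<Sum>i\<in>UNIV. h $ i *\<^sub>R p' (axis i 1))" for h
    using p by (intro linear_eq_sum_axis bounded_linear.linear has_derivative_bounded_linear)
  ultimately have "p' = (\<lambda>h. \<Sum>i\<in>UNIV. h $ i *\<^sub>R \<Phi> x $ i)"
    by presburger
  with p show ?thesis by simp
qed

text \<open>Moving \<open>q x\<close> back by \<open>T (- p x)\<close> undoes its motion: the
  derivative of \<open>q\<close> cancels that of the group factor. The result is constant on the
  convex set \<open>W\<close>, with value \<open>q x\<^sub>0\<close> because
  \<open>p x\<^sub>0 = 0\<close>.\<close>

lemma orbit_of_primitive:
  fixes T :: "real^'d::finite \<Rightarrow> 'h::banach \<Rightarrow> 'h" and q :: "'e::euclidean_space \<Rightarrow> 'h"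
  assumes T: "C0_group T" and W: "convex W" "open W" "x\<^sub>0 \<in> W"
    and dom: "\<And>x. x \<in> W \<Longrightarrow> q x \<in> generator_dom T"
    and p: "\<And>x. x \<in> W \<Longrightarrow> (p has_derivative p' x) (at x)" "p x\<^sub>0 = 0"
    and q: "\<And>x. x \<in> W \<Longrightarrow> (q has_derivative (\<lambda>h. \<Sum>k\<in>UNIV. p' x h $ k *\<^sub>R generator T k (q x))) (at x)"
    and "x \<in> W"
  shows "q x = T (p x) (q x\<^sub>0)"
proof -
  have const: "((\<lambda>x. T (- p x) (q x)) has_derivative (\<lambda>h. 0)) (at a within W)" if a: "a \<in> W" for a
  proof -
    have lin: "linear (T t)" for t
      using C0_groupD(1)[OF T] by (rule bounded_linear.linear)
    have p_minus: "((\<lambda>x. - p x) has_derivative (\<lambda>h. - p' a h)) (at a)"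
      using p(1)[OF a] by (rule has_derivative_minus)
    \<comment> \<open>Freezing the vector \<open>q a\<close> reduces the group factor to an orbit,
      differentiable since \<open>q a\<close> lies in the domain of the generator.\<close>
    from diff_chain_at[OF this orbit_has_derivative[OF T dom[OF a]]]
    have D: "((\<lambda>x. T (- p x) (q a)) has_derivative
        (\<lambda>h. \<Sum>k\<in>UNIV. (- p' a h) $ k *\<^sub>R T (- p a) (generator T k (q a)))) (at a)"
      by (simp add: o_def)
    from C0_group_has_derivative[OF T q[OF a] has_derivative_continuous[OF p_minus] D]
    have "((\<lambda>x. T (- p x) (q x)) has_derivative (\<lambda>h. 0)) (at a)"
      by (simp add: linear_sum[OF lin] linear_scale[OF lin] sum_negf)
    then show ?thesis by (rule has_derivative_at_withinI)
  qed
  have "\<exists>c. \<forall>x\<in>W. T (- p x) (q x) = c"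
    by (rule has_derivative_zero_constant[OF W(1) const])
  then have "T (- p x) (q x) = T (- p x\<^sub>0) (q x\<^sub>0)"
    using \<open>x \<in> W\<close> W(3) by auto
  then have "T (p x) (T (- p x) (q x)) = T (p x) (q x\<^sub>0)"
    using p(2) by (simp add: C0_groupD(2)[OF T])
  then show ?thesis
    by (simp add: C0_groupD(2)[OF T] flip: C0_groupD(3)[OF T])
qed

text \<open>Points of \<open>\<M>\<close> have type \<open>'g\<close>, and \<open>j\<close> carries
  them into H. The map \<open>e\<close> matches the index type \<open>'m\<close> with the first
  noise components. Since \<open>independent\<close> concerns the set of values, \<open>inj\<close>
  is added to exclude repetitions in the family.\<close>

theorem theorem6p6:
  fixes \<iota>\<^sub>G :: "'g::{real_inner, banach, second_countable_topology} \<Rightarrow>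
                'k::{real_inner, banach, second_countable_topology}"
    and \<iota> :: "'k \<Rightarrow> 'h::{real_inner, banach, second_countable_topology}"
    and L :: "'g \<Rightarrow> 'h"
    and A :: "nat \<Rightarrow> 'g \<Rightarrow> 'h"
    and T :: "real^'d::finite \<Rightarrow> 'h \<Rightarrow> 'h"
    and B :: "'d \<Rightarrow> 'h \<Rightarrow> 'h"
    and e :: "'m::finite \<Rightarrow> nat"
    and \<M> :: "'g set"
    and y\<^sub>0 :: 'g
    and U :: "'h set"
    and V :: "(real^'m) set"
    and \<phi> :: "real^'m \<Rightarrow> 'g"
    and x\<^sub>0 :: "real^'m"
    and \<Lambda> :: "real^'m \<Rightarrow> real^'d^'m"
    and \<Gamma> :: "real^'m \<Rightarrow> real^'m^'m"
    and \<Phi> :: "real^'m \<Rightarrow> real^'d^'m"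
    and \<psi> :: "real^'d \<Rightarrow> 'h"
  defines "j \<equiv> \<iota> \<circ> \<iota>\<^sub>G"
  assumes "continuous_embedding \<iota>\<^sub>G" and "continuous_embedding \<iota>"
    and "continuous_on UNIV L" and "continuous_ell2 A"
    and "C0_group T" and "B = generator T"
    and "C0_group_restricts T j" and "C0_group_restricts T \<iota>"
    and "range \<iota> \<subseteq> generator_dom T" and "range j \<subseteq> generator_dom2 T"
    and "\<And>i. bounded_linear (\<lambda>x. B i (\<iota> x))"
    and "\<And>i. \<exists>C :: 'g \<Rightarrow> 'k. bounded_linear C \<and> (\<forall>x. \<iota> (C x) = B i (j x))"
    and "CARD('m) \<le> CARD('d)"
    and "bij_betw e UNIV {..<CARD('m)}"
    and "GHH_submanifold_C2 TYPE('m) \<iota>\<^sub>G \<iota> \<M>"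
    and "locally_invariant TYPE('w) j L A \<M>"
    and "\<And>i. \<exists>A\<^sub>0 :: 'g \<Rightarrow> 'k. continuous_on UNIV A\<^sub>0 \<and> (\<forall>y. \<iota> (A\<^sub>0 y) = A (e i) y)"
    and "\<And>i. \<exists>A\<^sub>1 :: 'k \<Rightarrow> 'h. C1_on UNIV A\<^sub>1 \<and> (\<forall>y. A\<^sub>1 (\<iota>\<^sub>G y) = A (e i) y)"
    and "y\<^sub>0 \<in> \<M>" and "j y\<^sub>0 \<in> U"
    and "local_parametrization C2_on U V (j ` \<M>) (j \<circ> \<phi>)"
    and "\<phi> ` V \<subseteq> \<M>"
    and "continuous_on V \<phi>" and "C1_on V (\<iota>\<^sub>G \<circ> \<phi>)"
    and "x\<^sub>0 = the_inv_into V \<phi> y\<^sub>0"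
    and "C1_on V \<Lambda>"
    and "\<And>y i. y \<in> \<M> \<Longrightarrow> j y \<in> U \<Longrightarrow>
           A (e i) y = (\<Sum>k\<in>UNIV. (\<Lambda> (the_inv_into V \<phi> y) $ i $ k) *\<^sub>R B k (j y))"
    and "\<And>y. y \<in> \<M> \<Longrightarrow> j y \<in> U \<Longrightarrow>
           inj (\<lambda>i. A (e i) y) \<and> independent (range (\<lambda>i. A (e i) y))"
    and "\<And>x i. x \<in> V \<Longrightarrow>
           partial_derivative i (j \<circ> \<phi>) x = (\<Sum>l\<in>UNIV. (\<Gamma> x $ i $ l) *\<^sub>R A (e l) (\<phi> x))"
    and "\<Phi> = (\<lambda>x. \<Gamma> x ** \<Lambda> x)"
    and "\<psi> = (\<lambda>t. T t (j y\<^sub>0))"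
    and "\<exists>p. primitive_on V \<Phi> p"
    and "rank (\<Phi> x\<^sub>0) = CARD('m)"
  shows "\<exists>(N :: (real^'d) set) U\<^sub>0. C2_submanifold TYPE('m) N \<and>
           open U\<^sub>0 \<and> U\<^sub>0 \<subseteq> U \<and> j y\<^sub>0 \<in> U\<^sub>0 \<and>
           induced_by TYPE('m) (U\<^sub>0 \<inter> j ` \<M>) \<psi> N"
proof -
  have emb_G: "continuous_embedding \<iota>\<^sub>G" and emb: "continuous_embedding \<iota>" and T: "C0_group T"
    and B: "B = generator T" and dom2: "range j \<subseteq> generator_dom2 T"
    and A1: "\<And>i. \<exists>A\<^sub>1 :: 'k \<Rightarrow> 'h. C1_on UNIV A\<^sub>1 \<and> (\<forall>y. A\<^sub>1 (\<iota>\<^sub>G y) = A (e i) y)"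
    and y0: "y\<^sub>0 \<in> \<M>" "j y\<^sub>0 \<in> U"
    and par: "local_parametrization C2_on U V (j ` \<M>) (j \<circ> \<phi>)"
    and \<phi>M: "\<phi> ` V \<subseteq> \<M>" and \<phi>C1: "C1_on V (\<iota>\<^sub>G \<circ> \<phi>)"
    and x0: "x\<^sub>0 = the_inv_into V \<phi> y\<^sub>0" and \<Lambda>: "C1_on V \<Lambda>"
    and A: "\<And>y i. y \<in> \<M> \<Longrightarrow> j y \<in> U \<Longrightarrow>
           A (e i) y = (\<Sum>k\<in>UNIV. (\<Lambda> (the_inv_into V \<phi> y) $ i $ k) *\<^sub>R B k (j y))"
    and indep: "\<And>y. y \<in> \<M> \<Longrightarrow> j y \<in> U \<Longrightarrow>
           inj (\<lambda>i. A (e i) y) \<and> independent (range (\<lambda>i. A (e i) y))"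
    and \<Gamma>: "\<And>x i. x \<in> V \<Longrightarrow>
           partial_derivative i (j \<circ> \<phi>) x = (\<Sum>l\<in>UNIV. (\<Gamma> x $ i $ l) *\<^sub>R A (e l) (\<phi> x))"
    and \<Phi>: "\<Phi> = (\<lambda>x. \<Gamma> x ** \<Lambda> x)" and \<psi>: "\<psi> = (\<lambda>t. T t (j y\<^sub>0))"
    and prim: "\<exists>p. primitive_on V \<Phi> p"
    by fact+
  define q where "q = j \<circ> \<phi>"
  have inj_j: "inj j"
    using emb emb_G unfolding j_def continuous_embedding_def by (auto intro: inj_compose)
  obtain g where "open U" "open V" and q: "C2_on V q" "homeomorphism V (U \<inter> j ` \<M>) q g"
    and inj_q: "\<And>x. x \<in> V \<Longrightarrow> inj (frechet_derivative q (at x))"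
    using par unfolding local_parametrization_def q_def by blast
  have "inj_on q V"
    using q(2) by (metis homeomorphism_def inj_on_inverseI)
  then have inj_\<phi>: "inj_on \<phi> V"
    unfolding q_def by (rule inj_on_imageI2)
  have qU: "j (\<phi> x) \<in> U" "\<phi> x \<in> \<M>" if "x \<in> V" for x
    using q(2) \<phi>M that by (auto simp: homeomorphism_def q_def)
  \<comment> \<open>\<open>the_inv_into\<close> yields a preimage only for points of the image; that
    \<open>y\<^sub>0\<close> is one is pulled back from H by injectivity of
    \<open>j\<close>.\<close>
  have "j y\<^sub>0 \<in> q ` V"
    using y0 q(2) by (auto simp: homeomorphism_def)
  then have "y\<^sub>0 \<in> \<phi> ` V"
    using inj_j by (auto simp: q_def dest: injD)
  then have x0V: "x\<^sub>0 \<in> V" and \<phi>x0: "\<phi> x\<^sub>0 = y\<^sub>0"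
    using inj_\<phi> by (auto simp: x0 the_inv_into_f_f)
  have dq: "(q has_derivative frechet_derivative q (at x)) (at x)" if "x \<in> V" for x
    using C2_onD(1)[OF q(1) that] .
  have dq_axis: "frechet_derivative q (at x) (axis i 1) = (\<Sum>l\<in>UNIV. \<Gamma> x $ i $ l *\<^sub>R A (e l) (\<phi> x))"
    if "x \<in> V" for x i
    using \<Gamma>[OF that, of i] partial_derivative_eq[OF dq[OF that], of i] by (simp add: q_def)
  \<comment> \<open>\<open>\<phi>\<close> is C1 as a map into the intermediate space, so the
    extension of \<open>A (e i)\<close> to that space is the one to compose with.\<close>
  have C1_A: "C1_on V (\<lambda>x. A (e i) (\<phi> x))" for i
  proof -
    obtain A\<^sub>1 :: "'k \<Rightarrow> 'h" where "C1_on UNIV A\<^sub>1" "\<And>y. A\<^sub>1 (\<iota>\<^sub>G y) = A (e i) y"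
      using A1[of i] by blast
    with C1_on_compose[OF _ \<phi>C1, of A\<^sub>1] show ?thesis by simp
  qed
  \<comment> \<open>The derivatives of \<open>q\<close> in the axis directions are C1 because
    \<open>q\<close> is C2, and \<open>\<Gamma>\<close> holds their coefficients in the C1 frame
    \<open>A (e l) (\<phi> x)\<close>.\<close>
  have C1_\<Gamma>: "C1_on V (\<lambda>x. \<Gamma> x $ i $ l)" for i l
  proof (rule C1_on_coefficients[OF \<open>open V\<close> C1_A])
    show "C1_on V (\<lambda>x. frechet_derivative q (at x) (axis i 1))"
      by (rule C2_onD(2)[OF q(1) \<open>open V\<close>])
  qed (use dq_axis indep qU in auto)
  have C1_\<Phi>: "C1_on V (\<lambda>x. \<Phi> x $ i)" for i
  proof -
    have "\<Phi> x $ i = (\<Sum>l\<in>UNIV. \<Gamma> x $ i $ l *\<^sub>R \<Lambda> x $ l)" for x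
      by (simp add: \<Phi> matrix_matrix_mult_def vec_eq_iff)
    then show ?thesis
      using C1_\<Gamma> C1_on_linear_compose[OF bounded_linear_vec_nth \<Lambda>]
      by (simp add: C1_on_sum C1_on_bilinear[OF bounded_bilinear_scaleR])
  qed
  obtain p\<^sub>1 where p1: "primitive_on V \<Phi> p\<^sub>1" using prim by blast
  \<comment> \<open>Subtracting the value at \<open>x\<^sub>0\<close> keeps the derivative and makes
    the orbit start at \<open>j y\<^sub>0\<close>.\<close>
  define p where "p x = p\<^sub>1 x - p\<^sub>1 x\<^sub>0" for x
  define p' where "p' x h = (\<Sum>i\<in>UNIV. h $ i *\<^sub>R \<Phi> x $ i)" for x h
  have dp: "(p has_derivative p' x) (at x)" if "x \<in> V" for x
    using has_derivative_diff[OF primitive_on_has_derivative[OF p1 that] has_derivative_const]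
    by (simp add: p_def[abs_def] p'_def[abs_def])
  have p: "C2_on V p"
    by (rule C2_onI[OF _ C1_\<Phi>]) (use dp in \<open>simp add: p'_def[abs_def]\<close>)
  have dq': "(q has_derivative (\<lambda>h. \<Sum>k\<in>UNIV. p' x h $ k *\<^sub>R generator T k (q x))) (at x)" if x: "x \<in> V" for x
  proof -
    have "A (e l) (\<phi> x) = (\<Sum>k\<in>UNIV. \<Lambda> x $ l $ k *\<^sub>R B k (q x))" for l
      using A[OF qU(2,1)[OF x]] x inj_\<phi> by (simp add: the_inv_into_f_f q_def)
    then have "frechet_derivative q (at x) (axis i 1)
        = (\<Sum>l\<in>UNIV. \<Sum>k\<in>UNIV. (\<Gamma> x $ i $ l * \<Lambda> x $ l $ k) *\<^sub>R B k (q x))" for i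
      by (simp add: dq_axis[OF x] scaleR_sum_right)
    \<comment> \<open>Exchanging the sums collects the entries of the product
      \<open>\<Gamma> x ** \<Lambda> x\<close>.\<close>
    then have axis: "frechet_derivative q (at x) (axis i 1) = (\<Sum>k\<in>UNIV. \<Phi> x $ i $ k *\<^sub>R B k (q x))" for i
      by (subst (asm) sum.swap) (simp add: \<Phi> matrix_matrix_mult_def scaleR_sum_left)
    have "frechet_derivative q (at x) h = (\<Sum>k\<in>UNIV. p' x h $ k *\<^sub>R B k (q x))" for h
    proof -
      have "frechet_derivative q (at x) h = (\<Sum>i\<in>UNIV. \<Sum>k\<in>UNIV. (h $ i * \<Phi> x $ i $ k) *\<^sub>R B k (q x))"
        using linear_eq_sum_axis[of "frechet_derivative q (at x)" h] dq[OF x]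
        by (simp add: axis scaleR_sum_right has_derivative_bounded_linear bounded_linear.linear)
      then show ?thesis
        by (subst (asm) sum.swap) (simp add: p'_def scaleR_sum_left)
    qed
    then have "frechet_derivative q (at x) = (\<lambda>h. \<Sum>k\<in>UNIV. p' x h $ k *\<^sub>R B k (q x))"
      by (rule ext)
    then show ?thesis
      using dq[OF x] by (simp add: B)
  qed
  obtain r where r: "r > 0" "ball x\<^sub>0 r \<subseteq> V"
    using \<open>open V\<close> x0V open_contains_ball by blast
  \<comment> \<open>A ball is convex, as needed to pass from zero derivative to a constant.\<close>
  define W where "W = ball x\<^sub>0 r"
  have W: "open W" "convex W" "x\<^sub>0 \<in> W" "W \<subseteq> V"
    using r by (auto simp: W_def)
  have "q x = T (p x) (q x\<^sub>0)" if "x \<in> W" for x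
  proof (rule orbit_of_primitive[where p' = p', OF T W(2,1,3) _ _ _ _ that])
    show "q x \<in> generator_dom T" for x
      using dom2 by (auto simp: q_def generator_dom2_def)
    show "p x\<^sub>0 = 0" by (simp add: p_def)
  qed (use W(4) dp dq' in auto)
  then have eq: "q x = \<psi> (p x)" if "x \<in> W" for x
    using that by (simp add: \<psi> q_def \<phi>x0)
  have C2_\<psi>: "C2_on UNIV \<psi>"
    unfolding \<psi> using dom2 by (intro orbit_C2 T) auto
  have hom_W: "homeomorphism W (q ` W) q g"
    using homeomorphism_of_subsets[OF q(2) W(4)] q(2) W(4) by (auto simp: homeomorphism_def)
  \<comment> \<open>A homeomorphism maps the open set \<open>W\<close> to a relatively open set, so
    within \<open>U\<close> an open \<open>O'\<close> cuts out exactly the image of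
    \<open>W\<close>, and \<open>U \<inter> O'\<close> serves as the neighborhood.\<close>
  have "openin (top_of_set (U \<inter> j ` \<M>)) (q ` W)"
    using homeomorphism_imp_open_map[OF q(2)] W by (simp add: open_subset)
  then obtain O' where O': "open O'" "q ` W = (U \<inter> j ` \<M>) \<inter> O'"
    by (auto simp: openin_open)
  have "C2_submanifold TYPE('m) (p ` W) \<and> induced_by TYPE('m) (q ` W) \<psi> (p ` W)"
    using induced_by_factorization[OF W(1) C2_on_subset[OF q(1) W(4)] hom_W _
        C2_on_subset[OF p W(4)] C2_\<psi> eq] inj_q W(4) by blast
  moreover have "q ` W = U \<inter> O' \<inter> j ` \<M>"
    using O'(2) by blast
  moreover have "j y\<^sub>0 \<in> U \<inter> O'"
    using O'(2) W(3) \<phi>x0 by (auto simp: q_def)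
  ultimately show ?thesis
    using \<open>open U\<close> O'(1) by (intro exI[of _ "p ` W"] exI[of _ "U \<inter> O'"]) auto
qed

end
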